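(* Let $E$ be an integral basis of the lattice $\Lambda$ in the rational space $(X,\Lambda)$, let $C=\sum_{e\in E}\mathbb{R}_+e$, and let $\varphi\in\mathcal{S}(X)$. For each positive integer $r$ and positive number $K$ with $r<K<2r$, there exists a positive constant $C_{r,K}$ such that for $x\in C$ and every positive integer $N$, $$S_N(\varphi)(x)=\sum_{\mu\in\mathbb{Z}_+^E,\ |\mu|\le2r-1}\frac{\nabla^\mu\varphi(x)}{\mu!\,N^{|\mu|}}J_\mu(Nx)+S_{2r,N}(x),$$ where the function $S_{2r,N}(x)$ satisfies $$|S_{2r,N}(x)|\le C_{r,K}N^{-r}(1+|x|)^{r-K},\qquad x\in C,$$ with the norm $|x|^2=\sum_{e\in E}x(e)^2$, and $J_\mu(x)$ is a polynomial in $x$ of degree at most $[|\mu|/2]$ given by $$J_\mu(x)=\sum_{\nu\in\mathbb{Z}_+^E,\ \nu\le[\mu/2]}p_E(\mu,\nu)x^\nu,$$ where $[\mu/2]\in\mathbb{Z}_+^E$ is defined by $[\mu/2](e)=[\mu(e)/2]$.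
   Context: $(X,\Lambda)$ is a finite-dimensional real vector space with a lattice $\Lambda$; an integral basis is a $\mathbb{Z}$-basis of $\Lambda$. Via $E$, $X=\mathbb{R}^E$ (functions $E\to\mathbb{R}$; $x(e)$ is the coordinate of $x$ at $e$), $\Lambda=\mathbb{Z}^E$, $C=\mathbb{R}_+^E$, with $\mathbb{R}_+,\mathbb{Z}_+$ the non-negative reals/integers. For $\alpha\in\mathbb{Z}_+^E$: $\alpha!=\prod_e\alpha(e)!$, $x^\alpha=\prod_ex(e)^{\alpha(e)}$, $|\alpha|=\sum_e\alpha(e)$, $\nabla^\alpha=\prod_e\nabla_e^{\alpha(e)}$ ($\nabla_e$ = derivative in direction $e$), and $\le$ is componentwise; $[\cdot]$ is the integer part. For $\gamma\in\mathbb{Z}_+^E$, $\ell_\gamma(x)=\frac{x^\gamma}{\gamma!}e^{-\sum_ex(e)}$. The Szasz function of $\varphi$ is $S_N(\varphi)(x)=\sum_{\gamma\in\mathbb{Z}_+^E}\ell_\gamma(Nx)\varphi(\gamma/N)$. The Stirling numbers of the second kind are $S(0,0)=1$, $S(n,0)=0$, $S(n,n)=1$ $(n\ge1)$, $S(n+1,k)=kS(n,k)+S(n,k-1)$ $(1\le k\le n)$; $p(n,k)=\sum_{t=0}^k\binom nt(-1)^tS(n-t,k-t)$ for $0\le k\le n$; $p_E(\mu,\nu)=\prod_{e\in E}p(\mu(e),\nu(e))$ for $\nu\le\mu$. The constant $C_{r,K}$ may depend on $\varphi$ but not on $x$ or $N$. *)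

theory Defs
  imports "HOL-Analysis.Analysis" "HOL-Combinatorics.Stirling"
begin

section \<open>Lattices and integral bases\<close>

definition int_span :: "'a::real_vector set \<Rightarrow> 'a set" where
  "int_span B = {\<Sum>b\<in>B. real_of_int (c b) *\<^sub>R b | c. True}"

text \<open>A lattice in a finite-dimensional real vector space is the set of integer combinations of
  some vector space basis. In particular, the existence of a lattice makes the space
  finite-dimensional.\<close>

definition is_lattice :: "'a::real_vector set \<Rightarrow> bool" where
  "is_lattice \<Lambda> \<longleftrightarrow> (\<exists>B. finite B \<and> independent B \<and> span B = UNIV \<and> \<Lambda> = int_span B)"

text \<open>A \<open>\<int>\<close>-basis of \<open>\<Lambda>\<close>: every element of \<open>\<Lambda>\<close> is a unique integer combination.
  (A \<open>\<int>\<close>-basis of a lattice is finite, and it is also a basis of the real vector space.)\<close>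

definition integral_basis :: "'a::real_vector set \<Rightarrow> 'a set \<Rightarrow> bool" where
  "integral_basis E \<Lambda> \<longleftrightarrow> finite E \<and> E \<subseteq> \<Lambda> \<and>
     (\<forall>v\<in>\<Lambda>. \<exists>!c::'a \<Rightarrow> int. c \<in> E \<rightarrow>\<^sub>E UNIV \<and> v = (\<Sum>e\<in>E. real_of_int (c e) *\<^sub>R e))"

definition orthant :: "'a::real_vector set \<Rightarrow> 'a set" where
  "orthant E = {\<Sum>e\<in>E. c e *\<^sub>R e | c. \<forall>e\<in>E. (0::real) \<le> c e}"

text \<open>The coordinate \<open>x(e)\<close> is \<^term>\<open>representation E x e\<close>; \<open>|x|\<close> is the Euclidean norm of
  the coordinate vector, not the norm of the ambient type.\<close>

definition coord_norm :: "'a::real_vector set \<Rightarrow> 'a \<Rightarrow> real" where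
  "coord_norm E x = L2_set (representation E x) E"


section \<open>Multi-indices\<close>

text \<open>Multi-indices are extensional (equal to \<^term>\<open>undefined\<close> off \<open>E\<close>), so that each element of
  \<open>\<int>\<^sub>+\<^sup>E\<close> is represented by exactly one function when summing over all multi-indices.\<close>

definition multi_indices :: "'a set \<Rightarrow> ('a \<Rightarrow> nat) set" where
  "multi_indices E = E \<rightarrow>\<^sub>E UNIV"

definition mabs :: "'a set \<Rightarrow> ('a \<Rightarrow> nat) \<Rightarrow> nat" where
  "mabs E \<alpha> = (\<Sum>e\<in>E. \<alpha> e)"

definition mfact :: "'a set \<Rightarrow> ('a \<Rightarrow> nat) \<Rightarrow> real" where
  "mfact E \<alpha> = (\<Prod>e\<in>E. fact (\<alpha> e))"

definition mpow :: "'a::real_vector set \<Rightarrow> 'a \<Rightarrow> ('a \<Rightarrow> nat) \<Rightarrow> real" where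
  "mpow E x \<alpha> = (\<Prod>e\<in>E. representation E x e ^ \<alpha> e)"

definition poly_degree_le :: "'a::real_vector set \<Rightarrow> nat \<Rightarrow> ('a \<Rightarrow> real) \<Rightarrow> bool" where
  "poly_degree_le E d f \<longleftrightarrow>
     (\<exists>c. \<forall>x. f x = (\<Sum>\<alpha> | \<alpha> \<in> multi_indices E \<and> mabs E \<alpha> \<le> d. c \<alpha> * mpow E x \<alpha>))"


section \<open>Derivatives and Schwartz functions\<close>

definition dir_deriv :: "'a::real_normed_vector \<Rightarrow> ('a \<Rightarrow> complex) \<Rightarrow> 'a \<Rightarrow> complex" where
  "dir_deriv v f x = frechet_derivative f (at x) v"

text \<open>The operator \<open>\<nabla>\<^sup>\<alpha>\<close>. The directions in \<open>E\<close> are processed in an arbitrary order, which is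
  immaterial for smooth functions because there the directional derivatives commute.\<close>

definition multi_deriv ::
    "'a::real_normed_vector set \<Rightarrow> ('a \<Rightarrow> nat) \<Rightarrow> ('a \<Rightarrow> complex) \<Rightarrow> 'a \<Rightarrow> complex" where
  "multi_deriv E \<alpha> f =
     foldr (\<lambda>e. dir_deriv e ^^ \<alpha> e) (SOME es. distinct es \<and> set es = E) f"

text \<open>In finite dimension, a function is smooth iff all its iterated directional derivatives
  are (totally) differentiable, and all norms are equivalent, so that the following is the usual
  Schwartz space independently of the norm of the ambient type.\<close>

definition smooth :: "('a::real_normed_vector \<Rightarrow> complex) \<Rightarrow> bool" where
  "smooth f \<longleftrightarrow> (\<forall>vs x. foldr dir_deriv vs f differentiable (at x))"

definition schwartz :: "('a::real_normed_vector \<Rightarrow> complex) set" where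
  "schwartz = {\<phi>. smooth \<phi> \<and>
     (\<forall>k vs. bounded (range (\<lambda>x. norm x ^ k *\<^sub>R foldr dir_deriv vs \<phi> x)))}"


section \<open>Szasz functions\<close>

definition szasz_kernel :: "'a::real_vector set \<Rightarrow> ('a \<Rightarrow> nat) \<Rightarrow> 'a \<Rightarrow> real" where
  "szasz_kernel E \<gamma> x = mpow E x \<gamma> / mfact E \<gamma> * exp (- (\<Sum>e\<in>E. representation E x e))"

definition szasz :: "'a::real_vector set \<Rightarrow> nat \<Rightarrow> ('a \<Rightarrow> complex) \<Rightarrow> 'a \<Rightarrow> complex" where
  "szasz E N \<phi> x =
     (\<Sum>\<^sub>\<infinity>\<gamma>\<in>multi_indices E.
        szasz_kernel E \<gamma> (real N *\<^sub>R x) *\<^sub>R \<phi> (\<Sum>e\<in>E. (real (\<gamma> e) / real N) *\<^sub>R e))"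


section \<open>The polynomials \<open>J\<^sub>\<mu>\<close>\<close>

definition p_coeff :: "nat \<Rightarrow> nat \<Rightarrow> real" where
  "p_coeff n k = (\<Sum>t=0..k. real (n choose t) * (-1) ^ t * real (Stirling (n - t) (k - t)))"

definition p_multi :: "'a set \<Rightarrow> ('a \<Rightarrow> nat) \<Rightarrow> ('a \<Rightarrow> nat) \<Rightarrow> real" where
  "p_multi E \<mu> \<nu> = (\<Prod>e\<in>E. p_coeff (\<mu> e) (\<nu> e))"

definition J_poly :: "'a::real_vector set \<Rightarrow> ('a \<Rightarrow> nat) \<Rightarrow> 'a \<Rightarrow> real" where
  "J_poly E \<mu> x =
     (\<Sum>\<nu> | \<nu> \<in> multi_indices E \<and> (\<forall>e\<in>E. \<nu> e \<le> \<mu> e div 2). p_multi E \<mu> \<nu> * mpow E x \<nu>)"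

end

theory Submission
  imports Defs
begin

text \<open>The value \<open>S\<^sub>N(\<phi>)(x)\<close> is the expectation of \<open>\<phi>(Y/N)\<close> for independent Poisson variables
  \<open>Y(e)\<close> of mean \<open>N x(e)\<close>. Taylor's formula of order \<open>2r\<close> at \<open>x\<close> turns the main terms into central
  Poisson moments, whose coefficients are the numbers \<open>p(n,k)\<close>; these satisfy
  \<open>p(n+1,k) = k p(n,k) + n p(n-1,k-1)\<close>, hence vanish for \<open>2k > n\<close>. With \<open>h = Y/N - x\<close>, the
  Taylor remainder is at most a constant times \<open>|h|^(2r) (1+|h|)^(4r) (1+|x|)^(-4r)\<close> by the rapid decay
  of the derivatives of \<open>\<phi>\<close>. As the moment of \<open>|h|\<close> of order \<open>2m\<close> is at most a constant times
  \<open>N^(-m) (1+|x|)^m\<close>, this gives the error bound \<open>N^(-r) (1+|x|)^(-r)\<close>, which is stronger than the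
  required one since \<open>K < 2r\<close>.\<close>

section \<open>Coordinates with respect to an integral basis\<close>

text \<open>The exponent 4r comes from a balance. Moving a decay weight of exponent M from the
  intermediate points to x costs a factor (1+|h|)^M, which raises the order of the moments from 2r
  to 2r+M. These grow like (1+|x|)^(r+M/2), so the net power of 1+|x| is r-M/2, and M = 4r makes it
  -r. Only the orders 2r and 6r occur, because (1+|h|)^M <= 2^M (1+|h|^M). The vanishing of p(n,k)
  for 2k > n is the source of the power of N: it makes the central moment of order 2m a polynomial
  of degree at most m in the mean Nx, so that dividing by N^(2m) leaves N^(-m). A degree of 2m would
  leave no decay in N. In the estimates |h| and |x| are sums of absolute values of coordinates; the
  Euclidean norm enters only in the last comparison. Coordinates are values of
  \<open>representation E\<close>, which are meaningful only once E is known to be a basis over the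
  reals, whereas \<open>integral_basis\<close> speaks of integer coefficients only.\<close>

lemma integral_basis_is_basis:
  fixes \<Lambda> E :: "'a::real_vector set"
  assumes "is_lattice \<Lambda>" "integral_basis E \<Lambda>"
  shows "finite E" "independent E" "span E = UNIV"
proof -
  obtain B where B: "finite B" "independent B" "span B = UNIV" "\<Lambda> = int_span B"
    using assms(1) by (auto simp: is_lattice_def)
  show finE: "finite E"
    using assms(2) by (simp add: integral_basis_def)
  have sub: "E \<subseteq> \<Lambda>"
    and uniq: "\<And>v. v \<in> \<Lambda> \<Longrightarrow> \<exists>!c::'a \<Rightarrow> int. c \<in> E \<rightarrow>\<^sub>E UNIV \<and> v = (\<Sum>e\<in>E. real_of_int (c e) *\<^sub>R e)"
    using assms(2) by (auto simp: integral_basis_def)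
  have BL: "b \<in> \<Lambda>" if "b \<in> B" for b
  proof -
    have "b = (\<Sum>b'\<in>B. real_of_int (if b' = b then 1 else 0) *\<^sub>R b')"
      using that B(1) by (subst sum.remove[of _ b]) auto
    then show ?thesis
      unfolding B(4) int_span_def
      by (intro CollectI exI[of _ "\<lambda>b'. if b' = b then 1 else 0"] conjI TrueI)
  qed
  have "\<forall>b\<in>B. \<exists>c::'a \<Rightarrow> int. b = (\<Sum>e\<in>E. real_of_int (c e) *\<^sub>R e)"
    using BL uniq by blast
  then obtain c :: "'a \<Rightarrow> 'a \<Rightarrow> int"
    where c: "\<And>b. b \<in> B \<Longrightarrow> b = (\<Sum>e\<in>E. real_of_int (c b e) *\<^sub>R e)"
    by metis
  have "\<forall>e\<in>E. \<exists>a::'a \<Rightarrow> int. e = (\<Sum>b\<in>B. real_of_int (a b) *\<^sub>R b)"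
    using sub B(4) by (auto simp: int_span_def)
  then obtain a :: "'a \<Rightarrow> 'a \<Rightarrow> int"
    where a: "\<And>e. e \<in> E \<Longrightarrow> e = (\<Sum>b\<in>B. real_of_int (a e b) *\<^sub>R b)"
    by metis
  have "B \<subseteq> span E"
  proof
    fix b assume "b \<in> B"
    then have "b = (\<Sum>e\<in>E. real_of_int (c b e) *\<^sub>R e)" by (rule c)
    also have "\<dots> \<in> span E" by (intro span_sum span_scale span_base)
    finally show "b \<in> span E" .
  qed
  then show "span E = UNIV"
    using B(3) by (metis span_mono span_span top.extremum_uniqueI)
  \<comment> \<open>The integral matrices expressing \<open>E\<close> and \<open>B\<close> in terms of each other are inverse, because
    integral coordinates with respect to \<open>E\<close> are unique.\<close>
  have inverse: "(\<Sum>b\<in>B. a e b * c b e') = (if e' = e then 1 else 0)" if "e \<in> E" "e' \<in> E" for e e'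
  proof -
    define u where "u = restrict (\<lambda>e'. \<Sum>b\<in>B. a e b * c b e') E"
    define w where "w = restrict (\<lambda>e'. if e' = e then 1 else 0 :: int) E"
    have "e = (\<Sum>b\<in>B. real_of_int (a e b) *\<^sub>R (\<Sum>e'\<in>E. real_of_int (c b e') *\<^sub>R e'))"
      using a[OF that(1)] c by (simp cong: sum.cong)
    also have "\<dots> = (\<Sum>b\<in>B. \<Sum>e'\<in>E. real_of_int (a e b * c b e') *\<^sub>R e')"
      by (simp add: scaleR_sum_right)
    also have "\<dots> = (\<Sum>e'\<in>E. \<Sum>b\<in>B. real_of_int (a e b * c b e') *\<^sub>R e')"
      by (rule sum.swap)
    also have "\<dots> = (\<Sum>e'\<in>E. real_of_int (u e') *\<^sub>R e')"
      by (intro sum.cong refl) (simp add: u_def scaleR_sum_left)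
    finally have 1: "e = (\<Sum>e'\<in>E. real_of_int (u e') *\<^sub>R e')" .
    have 2: "e = (\<Sum>e'\<in>E. real_of_int (w e') *\<^sub>R e')"
      using that finE by (subst sum.remove[of _ e]) (auto simp: w_def)
    have "u \<in> E \<rightarrow>\<^sub>E UNIV" "w \<in> E \<rightarrow>\<^sub>E UNIV"
      by (auto simp: u_def w_def)
    then have "u = w"
      using uniq[of e] that sub 1 2 by blast
    then have "u e' = w e'" by simp
    then show ?thesis
      using that by (simp add: u_def w_def)
  qed
  \<comment> \<open>A relation with real coefficients is out of reach of integral uniqueness. It is
    rewritten in the real basis \<open>B\<close>, where all coefficients must vanish, and then
    multiplied by the inverse matrix \<open>c\<close>, which recovers \<open>u e0\<close>.\<close>
  show "independent E"
  proof
    assume "dependent E"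
    then obtain u e0 where u: "(\<Sum>e\<in>E. u e *\<^sub>R e) = 0" "e0 \<in> E" "u e0 \<noteq> 0"
      using finE by (auto simp: dependent_finite)
    have "0 = (\<Sum>e\<in>E. u e *\<^sub>R (\<Sum>b\<in>B. real_of_int (a e b) *\<^sub>R b))"
      using u(1) a by (simp cong: sum.cong)
    also have "\<dots> = (\<Sum>e\<in>E. \<Sum>b\<in>B. (u e * a e b) *\<^sub>R b)"
      by (simp add: scaleR_sum_right)
    also have "\<dots> = (\<Sum>b\<in>B. \<Sum>e\<in>E. (u e * a e b) *\<^sub>R b)"
      by (rule sum.swap)
    also have "\<dots> = (\<Sum>b\<in>B. (\<Sum>e\<in>E. u e * a e b) *\<^sub>R b)"
      by (simp add: scaleR_sum_left)
    finally have "(\<Sum>e\<in>E. u e * a e b) = 0" if "b \<in> B" for b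
      using independentD[OF B(2,1) order_refl _ that, of "\<lambda>b. \<Sum>e\<in>E. u e * a e b"] by simp
    then have "0 = (\<Sum>b\<in>B. (\<Sum>e\<in>E. u e * a e b) * c b e0)"
      by simp
    also have "\<dots> = (\<Sum>b\<in>B. \<Sum>e\<in>E. u e * (a e b * c b e0))"
      by (simp add: sum_distrib_right mult.assoc)
    also have "\<dots> = (\<Sum>e\<in>E. \<Sum>b\<in>B. u e * (a e b * c b e0))"
      by (rule sum.swap)
    also have "\<dots> = (\<Sum>e\<in>E. u e * of_int (\<Sum>b\<in>B. a e b * c b e0))"
      by (simp add: sum_distrib_left)
    also have "\<dots> = (\<Sum>e\<in>E. u e * (if e0 = e then 1 else 0))"
      using inverse u(2) by (intro sum.cong refl) simp
    also have "\<dots> = u e0"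
      using finE u(2) by (subst sum.remove[of _ e0]) (auto intro!: sum.neutral split: if_splits)
    finally show False using u(3) by simp
  qed
qed

text \<open>By compactness: the norm of the combination attains a minimum \<open>m\<close> on the l1
  unit sphere, independence makes \<open>m\<close> positive, and homogeneity gives the constant
  \<open>1 / m\<close>. Coefficient functions are pinned to 0 off \<open>E\<close>, so that the
  sphere is a closed subset of a product of compact sets.\<close>

lemma coordinates_bounded:
  fixes E :: "'a::real_normed_vector set"
  assumes "finite E" "independent E"
  obtains c where "c > 0" "\<And>u. (\<Sum>e\<in>E. \<bar>u e\<bar>) \<le> c * norm (\<Sum>e\<in>E. u e *\<^sub>R e)"
proof (cases "E = {}")
  case True
  then show ?thesis by (intro that[of 1]) auto
next
  case False
  define D where "D = PiE UNIV (\<lambda>e. if e \<in> E then {-1..1} else {0::real})"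
  define S where "S = D \<inter> {u. (\<Sum>e\<in>E. \<bar>u e\<bar>) = 1}"
  have coord: "continuous_on UNIV (\<lambda>u::'a \<Rightarrow> real. u e)" for e
    by simp
  have "compactin euclidean D"
    unfolding euclidean_product_topology[symmetric] D_def compactin_PiE by auto
  then have "compact D" by simp
  moreover have "closed {u :: 'a \<Rightarrow> real. (\<Sum>e\<in>E. \<bar>u e\<bar>) = 1}"
    by (intro closed_Collect_eq continuous_on_sum continuous_on_rabs coord continuous_on_const)
  ultimately have "compact S"
    unfolding S_def by blast
  have cont: "continuous_on S (\<lambda>u. norm (\<Sum>e\<in>E. u e *\<^sub>R e))"
    by (intro continuous_on_norm continuous_on_sum continuous_on_scaleR continuous_on_const
        continuous_on_subset[OF coord]) simp
  obtain e0 where "e0 \<in> E" using False by blast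
  then have "(\<lambda>e. if e = e0 then 1 else 0) \<in> S"
    using assms(1) by (auto simp: S_def D_def if_distrib[of abs] cong: if_cong)
  then have "S \<noteq> {}" by blast
  then obtain w where w: "w \<in> S"
    and min: "\<And>u. u \<in> S \<Longrightarrow> norm (\<Sum>e\<in>E. w e *\<^sub>R e) \<le> norm (\<Sum>e\<in>E. u e *\<^sub>R e)"
    using continuous_attains_inf[OF \<open>compact S\<close> _ cont] by blast
  define m where "m = norm (\<Sum>e\<in>E. w e *\<^sub>R e)"
  have "m \<noteq> 0"
  proof
    assume "m = 0"
    then have "\<forall>e\<in>E. w e = 0"
      using independentD[OF assms(2,1) order_refl, of w] by (simp add: m_def)
    then show False using w by (simp add: S_def)
  qed
  then have "m > 0" by (simp add: m_def)
  show ?thesis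
  proof (rule that[of "1 / m"])
    show "1 / m > 0" using \<open>m > 0\<close> by simp
    fix u :: "'a \<Rightarrow> real"
    define s where "s = (\<Sum>e\<in>E. \<bar>u e\<bar>)"
    show "(\<Sum>e\<in>E. \<bar>u e\<bar>) \<le> 1 / m * norm (\<Sum>e\<in>E. u e *\<^sub>R e)"
    proof (cases "s = 0")
      case True
      then show ?thesis using \<open>m > 0\<close> by (simp add: s_def)
    next
      case False
      then have "s > 0" by (simp add: s_def sum_nonneg order.not_eq_order_implies_strict)
      define v where "v e = (if e \<in> E then u e / s else 0)" for e
      have le: "\<bar>u e\<bar> \<le> s" if "e \<in> E" for e
        using that assms(1) member_le_sum[of e E "\<lambda>e. \<bar>u e\<bar>"] by (simp add: s_def)
      have "v \<in> S"
        using le \<open>s > 0\<close>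
        by (fastforce simp: S_def D_def v_def abs_le_iff field_simps s_def[symmetric]
            simp flip: sum_divide_distrib)
      then have "m \<le> norm (\<Sum>e\<in>E. v e *\<^sub>R e)"
        using min by (simp add: m_def)
      also have "(\<Sum>e\<in>E. v e *\<^sub>R e) = (1 / s) *\<^sub>R (\<Sum>e\<in>E. u e *\<^sub>R e)"
        by (simp add: v_def scaleR_sum_right)
      finally show ?thesis
        using \<open>s > 0\<close> \<open>m > 0\<close> by (simp add: s_def[symmetric] field_simps)
    qed
  qed
qed

lemma sum_abs_representation_le:
  fixes E :: "'a::real_normed_vector set"
  assumes "finite E" "independent E" "span E = UNIV"
  obtains c where "c > 0" "\<And>x. (\<Sum>e\<in>E. \<bar>representation E x e\<bar>) \<le> c * norm x"
proof -
  obtain c where c: "c > 0" "\<And>u. (\<Sum>e\<in>E. \<bar>u e\<bar>) \<le> c * norm (\<Sum>e\<in>E. u e *\<^sub>R e)"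
    using coordinates_bounded[OF assms(1,2)] by blast
  have "(\<Sum>e\<in>E. \<bar>representation E x e\<bar>) \<le> c * norm x" for x
    using c(2)[of "representation E x"] sum_representation_eq[OF assms(2) _ assms(1) order_refl, of x] assms(3)
    by simp
  with c(1) that show ?thesis by blast
qed

section \<open>Central moments of the Poisson distribution\<close>

text \<open>By inclusion-exclusion over t forced singletons, \<open>p_coeff n k\<close> counts the
  partitions of n points into k blocks without singletons. A further point either joins one of the k
  blocks or forms a pair with one of the n old points. The proof is algebraic, from Pascal's rule
  and the recurrence for \<open>Stirling\<close>.\<close>

lemma p_coeff_Suc:
  assumes "k > 0" "n > 0"
  shows "p_coeff (Suc n) k = real k * p_coeff n k + real n * p_coeff (n - 1) (k - 1)"
proof -
  obtain j m where [simp]: "k = Suc j" "n = Suc m" using assms by (metis Suc_pred)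
  let ?S = "\<lambda>a b. real (Stirling a b)"
  let ?b = "\<lambda>a b. real (a choose b) * (- 1) ^ b"
  have shift: "(\<Sum>t=0..k. f t) = f 0 + (\<Sum>t=0..j. f (Suc t))" for f :: "nat \<Rightarrow> real"
    by (simp only: \<open>k = Suc j\<close> sum.atLeast0_atMost_Suc_shift o_def)
  \<comment> \<open>The guard \<open>t < k\<close> matters: at t = k the truncated difference
    \<open>j - t\<close> is 0, and without the guard a spurious \<open>Stirling (n - k) 0\<close>
    would appear, which is 1 for n = k.\<close>
  have step: "?b n t * ?S (Suc n - t) (k - t)
      = ?b n t * (real (k - t) * ?S (n - t) (k - t)) + ?b n t * (if t < k then ?S (n - t) (j - t) else 0)"
    if "t \<le> k" for t
  proof (cases "t \<le> n")
    case True
    then have *: "Suc n - t = Suc (n - t)" by simp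
    show ?thesis
    proof (cases "t = k")
      case True
      then show ?thesis unfolding * by simp
    next
      case False
      then have tk: "t < k" and **: "k - t = Suc (j - t)" using that by auto
      show ?thesis unfolding * ** Stirling.simps using tk by (simp only: if_True of_nat_add of_nat_mult distrib_left)
    qed
  qed (simp add: binomial_eq_0)
  have "p_coeff (Suc n) k = ?S (Suc n) k
      + (\<Sum>t=0..j. real (Suc n choose Suc t) * (- 1) ^ Suc t * ?S (n - t) (j - t))"
    unfolding p_coeff_def shift by (simp del: binomial_Suc_Suc power_Suc)
  \<comment> \<open>Pascal's rule. The subtracted sum will cancel against the second summand of
    \<open>step\<close>.\<close>
  also have "(\<Sum>t=0..j. real (Suc n choose Suc t) * (- 1) ^ Suc t * ?S (n - t) (j - t))
     = (\<Sum>t=0..j. ?b n (Suc t) * ?S (n - t) (j - t)) - (\<Sum>t=0..j. ?b n t * ?S (n - t) (j - t))"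
    unfolding sum_subtractf[symmetric] by (intro sum.cong refl) (simp add: algebra_simps)
  also have "?S (Suc n) k + ((\<Sum>t=0..j. ?b n (Suc t) * ?S (n - t) (j - t)) - (\<Sum>t=0..j. ?b n t * ?S (n - t) (j - t)))
     = (\<Sum>t=0..k. ?b n t * ?S (Suc n - t) (k - t)) - (\<Sum>t=0..j. ?b n t * ?S (n - t) (j - t))"
    unfolding shift by (simp del: power_Suc Stirling.simps)
  also have "(\<Sum>t=0..k. ?b n t * ?S (Suc n - t) (k - t))
     = (\<Sum>t=0..k. ?b n t * (real (k - t) * ?S (n - t) (k - t)))
       + (\<Sum>t=0..k. ?b n t * (if t < k then ?S (n - t) (j - t) else 0))"
    unfolding sum.distrib[symmetric] by (intro sum.cong refl step) simp
  also have "(\<Sum>t=0..k. ?b n t * (if t < k then ?S (n - t) (j - t) else 0))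
     = (\<Sum>t=0..j. ?b n t * ?S (n - t) (j - t))"
    by (simp only: \<open>k = Suc j\<close> sum.atLeast0_atMost_Suc) (simp del: \<open>n = Suc m\<close>)
  \<comment> \<open>Splitting k - t leaves a sum weighted by t, which the absorption identity t
    C(n,t) = n C(n-1,t-1) turns into the term with \<open>p_coeff (n - 1) (k - 1)\<close>.\<close>
  also have "(\<Sum>t=0..k. ?b n t * (real (k - t) * ?S (n - t) (k - t)))
     = real k * p_coeff n k - (\<Sum>t=0..k. real t * ?b n t * ?S (n - t) (k - t))"
    unfolding p_coeff_def sum_distrib_left sum_subtractf[symmetric]
    by (intro sum.cong refl) (auto simp: of_nat_diff algebra_simps)
  also have "(\<Sum>t=0..k. real t * ?b n t * ?S (n - t) (k - t))
     = (\<Sum>t=0..j. real (Suc t) * ?b n (Suc t) * ?S (m - t) (j - t))"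
    unfolding shift by (simp del: power_Suc binomial_Suc_Suc of_nat_Suc)
  also have "\<dots> = (\<Sum>t=0..j. - real n * (?b m t * ?S (m - t) (j - t)))"
  proof (intro sum.cong refl)
    fix t
    have "real (Suc t) * real (n choose Suc t) = real n * real (m choose t)"
      unfolding \<open>n = Suc m\<close> of_nat_mult[symmetric] Suc_times_binomial_eq by (simp only: mult.commute)
    then show "real (Suc t) * ?b n (Suc t) * ?S (m - t) (j - t) = - real n * (?b m t * ?S (m - t) (j - t))"
      by (simp only: power_Suc mult_minus_left mult_minus_right mult_1 mult.assoc[symmetric]) 
  qed
  also have "\<dots> = - real n * p_coeff m j"
    by (simp only: p_coeff_def sum_distrib_left)
  finally show ?thesis by (simp add: algebra_simps)
qed

text \<open>Blocks without singletons have at least two points. In the recurrence the condition n <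
  2k passes to both terms; since it reaches two steps back, n = 0 and n = 1 are base cases.\<close>

lemma p_coeff_eq_0: "n < 2 * k \<Longrightarrow> p_coeff n k = 0"
proof (induction n arbitrary: k rule: less_induct)
  case (less n)
  consider "n = 0" | "n = 1" | m where "n = Suc m" "m > 0"
    by (metis One_nat_def not_gr_zero old.nat.exhaust)
  then show ?case
  proof cases
    case 1
    with less.prems obtain j where "k = Suc j" by (cases k) auto
    with 1 have "real (n choose t) * (- 1) ^ t * real (Stirling (n - t) (k - t)) = 0" for t
      by (cases t) auto
    then show ?thesis
      unfolding p_coeff_def by (intro sum.neutral ballI)
  next
    case 2
    with less.prems obtain j where k: "k = Suc j" by (cases k) auto
    have "p_coeff n k = (\<Sum>t\<in>{0,1}. real (1 choose t) * (- 1) ^ t * real (Stirling (n - t) (k - t)))"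
      unfolding p_coeff_def 2 using k
      by (intro sum.mono_neutral_right) (auto simp: binomial_eq_0)
    then show ?thesis
      using 2 k by (cases j) auto
  next
    case (3 m)
    then show ?thesis
      using p_coeff_Suc[of k m] less.IH[of m k] less.IH[of "m - 1" "k - 1"] less.prems by simp
  qed
qed

section \<open>Poisson moments via falling factorials\<close>

definition poisson_weight :: "real \<Rightarrow> nat \<Rightarrow> real" where
  "poisson_weight x y = x ^ y / fact y * exp (- x)"

lemma poisson_weight_nonneg: "x \<ge> 0 \<Longrightarrow> poisson_weight x y \<ge> 0"
  by (simp add: poisson_weight_def)

text \<open>This is where Stirling numbers enter: the factorial moments of a Poisson variable are
  plain powers of the mean, so ordinary moments are computed in the basis of falling
  factorials.\<close>

lemma power_eq_sum_Stirling_ffact: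
  "real y ^ n = (\<Sum>k\<le>n. real (Stirling n k) * (\<Prod>i<k. real y - real i))"
proof (induction n)
  case 0
  show ?case by simp
next
  case (Suc n)
  let ?f = "\<lambda>k. (\<Prod>i<k. real y - real i)"
  have "real y ^ Suc n = (\<Sum>k\<le>n. real (Stirling n k) * (real y * ?f k))"
    by (simp add: Suc sum_distrib_left mult_ac)
  also have "\<dots> = (\<Sum>k\<le>n. real (Stirling n k) * (?f (Suc k) + real k * ?f k))"
    by (intro sum.cong refl) (simp add: algebra_simps)
  also have "\<dots> = (\<Sum>k\<le>n. real (Stirling n k) * ?f (Suc k)) + (\<Sum>k\<le>Suc n. real (k * Stirling n k) * ?f k)"
    by (simp add: distrib_left sum.distrib mult_ac del: prod.lessThan_Suc)
  also have "(\<Sum>k\<le>Suc n. real (k * Stirling n k) * ?f k)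
      = (\<Sum>k\<le>n. real (Suc k * Stirling n (Suc k)) * ?f (Suc k))"
    by (subst sum.atMost_Suc_shift) simp
  also have "(\<Sum>k\<le>n. real (Stirling n k) * ?f (Suc k)) + (\<Sum>k\<le>n. real (Suc k * Stirling n (Suc k)) * ?f (Suc k))
      = (\<Sum>k\<le>n. real (Stirling (Suc n) (Suc k)) * ?f (Suc k))"
    by (simp add: sum.distrib[symmetric] algebra_simps del: prod.lessThan_Suc)
  also have "\<dots> = (\<Sum>k\<le>Suc n. real (Stirling (Suc n) k) * ?f k)"
    by (subst sum.atMost_Suc_shift) simp
  finally show ?case .
qed

text \<open>The first k terms vanish, and the series shifted by k is x^k exp(-x) times the
  exponential series.\<close>

lemma has_sum_poisson_ffact:
  assumes "x \<ge> 0"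
  shows "((\<lambda>y. poisson_weight x y * (\<Prod>i<k. real y - real i)) has_sum x ^ k) UNIV"
proof -
  let ?g = "\<lambda>y. poisson_weight x y * (\<Prod>i<k. real y - real i)"
  have small: "(\<Prod>i<k. real y - real i) = 0" if "y < k" for y
    using that by auto
  have fact: "(\<Prod>i<k. real (y + k) - real i) = fact (y + k) / fact y" for y
  proof (induction k arbitrary: y)
    case (Suc k)
    have "(\<Prod>i<Suc k. real (y + Suc k) - real i) = (\<Prod>i<k. real (Suc y + k) - real i) * real (Suc y)"
      by simp
    also have "\<dots> = fact (y + Suc k) / (real (Suc y) * fact y) * real (Suc y)"
      unfolding Suc[of "Suc y"] unfolding fact_Suc[of y] add_Suc_shift by (rule refl)
    also have "\<dots> = fact (y + Suc k) / fact y"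
      unfolding times_divide_eq_left mult.commute[of "real (Suc y)"]
      by (rule mult_divide_mult_cancel_right) (simp del: of_nat_Suc)
    finally show ?case .
  qed simp
  have eq: "?g (y + k) = (x ^ k * exp (- x)) * (x ^ y /\<^sub>R fact y)" for y
    by (simp only: fact) (simp add: poisson_weight_def power_add field_simps)
  have "(\<lambda>y. ?g (y + k)) sums ((x ^ k * exp (- x)) * exp x)"
    unfolding eq by (intro sums_mult exp_converges)
  then have "(\<lambda>y. ?g (y + k)) sums x ^ k"
    by (simp only: mult.assoc exp_minus_inverse mult.commute[of "exp (- x)"] mult_1_right)
  then have "?g sums (x ^ k + sum ?g {..<k})"
    by (rule iffD1[OF sums_iff_shift])
  moreover have "sum ?g {..<k} = 0"
    using small by (intro sum.neutral) auto
  \<comment> \<open>Nonnegative terms upgrade \<open>sums\<close> to the unconditional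
    \<open>has_sum\<close>. For y < k single factors may be negative, but the product is
    zero.\<close>
  moreover have "?g y \<ge> 0" for y
  proof (cases "y < k")
    case True
    then show ?thesis by (simp only: small mult_zero_right order_refl)
  next
    case False
    then show ?thesis
      using assms by (intro mult_nonneg_nonneg poisson_weight_nonneg prod_nonneg) auto
  qed
  ultimately show ?thesis
    using sums_nonneg_imp_has_sum[of ?g] by simp
qed

text \<open>Cut off at \<open>n div 2\<close> so as to be the one-variable factor of
  \<open>J_poly\<close>; the name is justified by
  \<open>has_sum_poisson_central_moment\<close>.\<close>

definition central_moment :: "nat \<Rightarrow> real \<Rightarrow> real" where
  "central_moment n x = (\<Sum>k\<le>n div 2. p_coeff n k * x ^ k)"

lemma has_sum_sum_finite:
  fixes f :: "'i \<Rightarrow> 'a \<Rightarrow> 'b::topological_comm_monoid_add"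
  assumes "\<And>i. i \<in> I \<Longrightarrow> (f i has_sum s i) A"
  shows "((\<lambda>x. \<Sum>i\<in>I. f i x) has_sum (\<Sum>i\<in>I. s i)) A"
  using assms by (induction I rule: infinite_finite_induct) (auto intro!: has_sum_add)

lemma has_sum_poisson_power:
  assumes "x \<ge> 0"
  shows "((\<lambda>y. poisson_weight x y * real y ^ n) has_sum (\<Sum>k\<le>n. real (Stirling n k) * x ^ k)) UNIV"
proof -
  have "((\<lambda>y. \<Sum>k\<le>n. real (Stirling n k) * (poisson_weight x y * (\<Prod>i<k. real y - real i)))
      has_sum (\<Sum>k\<le>n. real (Stirling n k) * x ^ k)) UNIV"
    by (intro has_sum_sum_finite has_sum_cmult_right has_sum_poisson_ffact assms)
  then show ?thesis
    by (simp add: power_eq_sum_Stirling_ffact sum_distrib_left mult_ac)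
qed

text \<open>The binomial theorem yields terms x^t x^k with coefficients C(n,t) (-1)^t S(n-t,k).
  Collecting the power m = t+k gives exactly the sum that defines \<open>p_coeff n m\<close>, and
  the terms beyond \<open>n div 2\<close> drop out by \<open>p_coeff_eq_0\<close>.\<close>

lemma has_sum_poisson_central_moment:
  assumes "x \<ge> 0"
  shows "((\<lambda>y. poisson_weight x y * (real y - x) ^ n) has_sum central_moment n x) UNIV"
proof -
  let ?T = "\<lambda>m. \<Sum>k\<le>m. real (Stirling m k) * x ^ k"
  have "((\<lambda>y. \<Sum>t\<le>n. real (n choose t) * (- x) ^ t * (poisson_weight x y * real y ^ (n - t)))
      has_sum (\<Sum>t\<le>n. real (n choose t) * (- x) ^ t * ?T (n - t))) UNIV"
    by (intro has_sum_sum_finite has_sum_cmult_right has_sum_poisson_power assms)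
  also have "(\<lambda>y. \<Sum>t\<le>n. real (n choose t) * (- x) ^ t * (poisson_weight x y * real y ^ (n - t)))
      = (\<lambda>y. poisson_weight x y * (real y - x) ^ n)"
  proof
    fix y
    have "(real y - x) ^ n = (\<Sum>t\<le>n. real (n choose t) * (- x) ^ t * real y ^ (n - t))"
      using binomial_ring[of "- x" "real y" n] by simp
    then show "(\<Sum>t\<le>n. real (n choose t) * (- x) ^ t * (poisson_weight x y * real y ^ (n - t)))
        = poisson_weight x y * (real y - x) ^ n"
      by (simp add: sum_distrib_left mult_ac)
  qed
  also have "(\<Sum>t\<le>n. real (n choose t) * (- x) ^ t * ?T (n - t))
      = (\<Sum>t\<le>n. \<Sum>m\<in>{t..n}. real (n choose t) * (- 1) ^ t * real (Stirling (n - t) (m - t)) * x ^ m)"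
  proof (intro sum.cong refl)
    fix t assume "t \<in> {..n}"
    then have t: "t \<le> n" by simp
    have "(\<Sum>m\<in>{t..n}. real (n choose t) * (- 1) ^ t * real (Stirling (n - t) (m - t)) * x ^ m)
        = (\<Sum>k\<le>n - t. real (n choose t) * (- 1) ^ t * real (Stirling (n - t) k) * x ^ (k + t))"
      using t by (intro sum.reindex_bij_witness[of _ "\<lambda>k. k + t" "\<lambda>m. m - t"]) auto
    then show "real (n choose t) * (- x) ^ t * ?T (n - t)
        = (\<Sum>m\<in>{t..n}. real (n choose t) * (- 1) ^ t * real (Stirling (n - t) (m - t)) * x ^ m)"
      by (simp add: sum_distrib_left power_add power_minus[of x] mult_ac)
  qed
  also have "\<dots> = (\<Sum>m\<le>n. \<Sum>t\<le>m. real (n choose t) * (- 1) ^ t * real (Stirling (n - t) (m - t)) * x ^ m)"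
  proof -
    have 1: "{t..n} = {m. m \<in> {..n} \<and> t \<le> m}" for t by auto
    have 2: "{t. t \<in> {..n} \<and> t \<le> m} = {..m}" if "m \<in> {..n}" for m using that by auto
    show ?thesis
      unfolding 1 by (subst sum.swap_restrict) (auto intro!: sum.cong simp: 2)
  qed
  also have "\<dots> = (\<Sum>m\<le>n. p_coeff n m * x ^ m)"
    by (simp add: p_coeff_def sum_distrib_right atMost_atLeast0)
  also have "\<dots> = central_moment n x"
  proof -
    have "p_coeff n k = 0" if "k \<in> {..n} - {..n div 2}" for k
      using that by (intro p_coeff_eq_0) auto
    then show ?thesis
      unfolding central_moment_def by (intro sum.mono_neutral_right) simp_all
  qed
  finally show ?thesis .
qed

text \<open>The polynomial has degree at most m. The base is 1 + x rather than x because lower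
  powers dominate near 0.\<close>

lemma central_moment_even_bound:
  obtains C where "C > 0" "\<And>x. x \<ge> 0 \<Longrightarrow> \<bar>central_moment (2 * m) x\<bar> \<le> C * (1 + x) ^ m"
proof
  define C where "C = 1 + (\<Sum>k\<le>m. \<bar>p_coeff (2 * m) k\<bar>)"
  show "C > 0" by (simp add: C_def add_pos_nonneg sum_nonneg)
  fix x :: real assume x: "x \<ge> 0"
  have "\<bar>central_moment (2 * m) x\<bar> \<le> (\<Sum>k\<le>m. \<bar>p_coeff (2 * m) k * x ^ k\<bar>)"
    unfolding central_moment_def by (rule order_trans[OF sum_abs]) simp
  also have "\<dots> \<le> (\<Sum>k\<le>m. \<bar>p_coeff (2 * m) k\<bar> * (1 + x) ^ m)"
  proof (intro sum_mono)
    fix k assume "k \<in> {..m}"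
    then have "x ^ k \<le> (1 + x) ^ m"
      using x order_trans[OF power_mono[of x "1 + x" k] power_increasing[of k m "1 + x"]] by simp
    then show "\<bar>p_coeff (2 * m) k * x ^ k\<bar> \<le> \<bar>p_coeff (2 * m) k\<bar> * (1 + x) ^ m"
      using x by (simp add: abs_mult mult_left_mono)
  qed
  also have "\<dots> \<le> C * (1 + x) ^ m"
    unfolding C_def sum_distrib_right[symmetric] using x by (intro mult_right_mono) auto
  finally show "\<bar>central_moment (2 * m) x\<bar> \<le> C * (1 + x) ^ m" .
qed

section \<open>Product sums over several coordinates\<close>

text \<open>For real families unconditional summability is absolute, which supplies the summability
  over the product set that an iterated sum alone does not give.\<close>

lemma has_sum_mult_Times:
  fixes f :: "'a \<Rightarrow> real" and g :: "'b \<Rightarrow> real"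
  assumes f: "(f has_sum a) A" and g: "(g has_sum b) B"
  shows "((\<lambda>(x, y). f x * g y) has_sum (a * b)) (A \<times> B)"
proof (rule has_sum_SigmaI)
  show "((\<lambda>y. case (x, y) of (x, y) \<Rightarrow> f x * g y) has_sum (f x * b)) B" for x
    using has_sum_cmult_right[OF g, of "f x"] by simp
  show "((\<lambda>x. f x * b) has_sum a * b) A"
    using has_sum_cmult_left[OF f, of b] by simp
  have absf: "(\<lambda>x. norm (f x)) summable_on A" and absg: "(\<lambda>y. norm (g y)) summable_on B"
    using f g has_sum_imp_summable summable_on_iff_abs_summable_on_real by blast+
  have "(\<lambda>x. \<bar>f x\<bar> * (\<Sum>\<^sub>\<infinity>y\<in>B. \<bar>g y\<bar>)) summable_on A"
    using absf by (intro summable_on_cmult_left) simp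
  then have "(\<lambda>z. norm (case z of (x, y) \<Rightarrow> f x * g y)) summable_on (A \<times> B)"
    unfolding Infinite_Sum.abs_summable_on_Sigma_iff using absg
    by (auto simp: abs_mult infsum_cmult_right' infsum_nonneg intro: summable_on_cmult_right)
  then show "(\<lambda>(x, y). f x * g y) summable_on (A \<times> B)"
    by (rule abs_summable_summable)
qed

text \<open>Independence of the coordinates: the expectation of a product is the product of the
  expectations. The induction splits off one coordinate through the bijection sending (y, g) to
  \<open>g(a := y)\<close>.\<close>

lemma has_sum_prod_PiE:
  fixes f :: "'a \<Rightarrow> 'b \<Rightarrow> real"
  assumes "finite A" "\<And>x. x \<in> A \<Longrightarrow> (f x has_sum s x) (B x)"
  shows "((\<lambda>g. \<Prod>x\<in>A. f x (g x)) has_sum (\<Prod>x\<in>A. s x)) (PiE A B)"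
  using assms
proof (induction A rule: finite_induct)
  case empty
  show ?case by (rule has_sum_finiteI) auto
next
  case (insert a A)
  have inj: "inj_on (\<lambda>(y, g). g(a := y)) (B a \<times> PiE A B)"
    using inj_combinator[OF insert.hyps(2)] .
  have "((\<lambda>(y, g). f a y * (\<Prod>x\<in>A. f x (g x))) has_sum (s a * (\<Prod>x\<in>A. s x))) (B a \<times> PiE A B)"
    by (intro has_sum_mult_Times insert) (use insert in auto)
  also have "(\<lambda>(y, g). f a y * (\<Prod>x\<in>A. f x (g x)))
      = (\<lambda>g. \<Prod>x\<in>insert a A. f x (g x)) \<circ> (\<lambda>(y, g). g(a := y))"
    using insert.hyps by (auto simp: fun_eq_iff intro!: prod.cong)
  finally show ?case
    by (simp only: PiE_insert_eq has_sum_reindex[OF inj] prod.insert[OF insert.hyps(1,2)])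
qed

section \<open>Taylor expansion\<close>

lemma finite_multi_indices_less:
  assumes "finite E"
  shows "finite {\<mu>. \<mu> \<in> multi_indices E \<and> mabs E \<mu> < m}"
proof (rule finite_subset)
  show "finite (PiE E (\<lambda>_. {..m}))"
    by (intro finite_PiE assms) simp
  show "{\<mu>. \<mu> \<in> multi_indices E \<and> mabs E \<mu> < m} \<subseteq> PiE E (\<lambda>_. {..m})"
  proof
    fix \<mu> assume "\<mu> \<in> {\<mu>. \<mu> \<in> multi_indices E \<and> mabs E \<mu> < m}"
    then have \<mu>: "\<mu> \<in> multi_indices E" "mabs E \<mu> < m" by auto
    have "\<mu> e \<le> mabs E \<mu>" if "e \<in> E" for e
      unfolding mabs_def using that assms by (intro member_le_sum) auto
    with \<mu> show "\<mu> \<in> PiE E (\<lambda>_. {..m})"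
      by (auto simp: multi_indices_def PiE_iff intro: order_trans less_imp_le)
  qed
qed

lemma smooth_foldr_dir_deriv:
  assumes "smooth f"
  shows "smooth (foldr dir_deriv vs f)"
  unfolding smooth_def
proof (intro allI)
  fix us x
  show "foldr dir_deriv us (foldr dir_deriv vs f) differentiable at x"
    using assms[unfolded smooth_def, rule_format, of "us @ vs" x] by simp
qed

text \<open>Brings the operators of \<open>multi_deriv\<close> into the list form in which
  \<open>smooth\<close> and \<open>schwartz\<close> are phrased.\<close>

lemma foldr_dir_deriv_funpow:
  "foldr (\<lambda>e. dir_deriv e ^^ \<mu> e) es f = foldr dir_deriv (concat (map (\<lambda>e. replicate (\<mu> e) e) es)) f"
  by (induction es) (simp_all add: foldr_replicate)

lemma has_vector_derivative_dir_deriv: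
  assumes "smooth f"
  shows "((\<lambda>t. f (x + (t * h) *\<^sub>R v)) has_vector_derivative h *\<^sub>R dir_deriv v f (x + (t * h) *\<^sub>R v)) (at t within S)"
proof -
  let ?p = "x + (t * h) *\<^sub>R v"
  have "f differentiable at ?p"
    using assms[unfolded smooth_def, rule_format, of "[]"] by simp
  then have D: "(f has_derivative frechet_derivative f (at ?p)) (at ?p)"
    by (simp add: frechet_derivative_works)
  have g: "((\<lambda>t. x + (t * h) *\<^sub>R v) has_derivative (\<lambda>s. (s * h) *\<^sub>R v)) (at t within S)"
    by (auto intro!: derivative_eq_intros)
  have "((\<lambda>t. f (x + (t * h) *\<^sub>R v)) has_derivative (\<lambda>s. frechet_derivative f (at ?p) ((s * h) *\<^sub>R v))) (at t within S)"
    using has_derivative_compose[OF g D] .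
  also have "(\<lambda>s. frechet_derivative f (at ?p) ((s * h) *\<^sub>R v)) = (\<lambda>s. s *\<^sub>R (h *\<^sub>R dir_deriv v f ?p))"
    using linear_cmul[OF has_derivative_linear[OF D]] by (simp add: dir_deriv_def fun_eq_iff)
  finally show ?thesis
    by (simp add: has_vector_derivative_def)
qed

text \<open>The remainder is taken in integral form, since complex values admit no mean value form;
  its kernel (1-t)^(n-1)/(n-1)! is simply bounded by 1. For n = 0 there is no such integral, and the
  claim is the hypothesis at t = 1.\<close>

lemma taylor_along_line:
  assumes "smooth f"
    and bound: "\<And>t. 0 \<le> t \<Longrightarrow> t \<le> 1 \<Longrightarrow> norm ((dir_deriv v ^^ n) f (x + (t * h) *\<^sub>R v)) \<le> B"
  shows "norm (f (x + h *\<^sub>R v) - (\<Sum>a<n. (h ^ a / fact a) *\<^sub>R (dir_deriv v ^^ a) f x)) \<le> \<bar>h\<bar> ^ n * B"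
proof (cases "n = 0")
  case True
  then show ?thesis using bound[of 1] by simp
next
  case False
  define Df where "Df a t = h ^ a *\<^sub>R (dir_deriv v ^^ a) f (x + (t * h) *\<^sub>R v)" for a t
  have sm: "smooth ((dir_deriv v ^^ a) f)" for a
    using smooth_foldr_dir_deriv[OF assms(1), of "replicate a v"] by (simp add: foldr_replicate)
  have D: "(Df a has_vector_derivative Df (Suc a) t) (at t within {0..1})" for a t
    using bounded_linear.has_vector_derivative[OF bounded_linear_scaleR_right
        has_vector_derivative_dir_deriv[OF sm], of "h ^ a" a x h v t "{0..1}"]
    by (simp add: Df_def[abs_def] mult.commute)
  have "B \<ge> 0"
    using order_trans[OF norm_ge_zero bound[of 0]] by simp
  have "((\<lambda>t. ((1 - t) ^ (n - 1) / fact (n - 1)) *\<^sub>R Df n t) has_integral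
      Df 0 1 - (\<Sum>a<n. ((1 - 0) ^ a / fact a) *\<^sub>R Df a 0)) {0..1}"
    using False D by (intro Taylor_has_integral) auto
  moreover have "norm (((1 - t) ^ (n - 1) / fact (n - 1)) *\<^sub>R Df n t) \<le> \<bar>h\<bar> ^ n * B" if "t \<in> cbox 0 1" for t :: real
  proof -
    have t: "0 \<le> t" "t \<le> 1" using that by auto
    have "(1 - t) ^ (n - 1) \<le> 1" using t by (intro power_le_one) auto
    moreover have "(1::real) \<le> fact (n - 1)" by (rule fact_ge_1)
    ultimately have 1: "(1 - t) ^ (n - 1) / fact (n - 1) \<le> 1"
      by (simp only: divide_le_eq_1_pos fact_gt_zero)
    have 2: "norm (Df n t) \<le> \<bar>h\<bar> ^ n * B"
      unfolding Df_def using bound[OF t] by (simp add: power_abs mult_left_mono)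
    have "norm (((1 - t) ^ (n - 1) / fact (n - 1)) *\<^sub>R Df n t)
        = (1 - t) ^ (n - 1) / fact (n - 1) * norm (Df n t)"
      using t by simp
    also have "\<dots> \<le> 1 * (\<bar>h\<bar> ^ n * B)"
      using t 1 2 by (intro mult_mono) auto
    finally show ?thesis by simp
  qed
  ultimately have "norm (Df 0 1 - (\<Sum>a<n. ((1 - 0) ^ a / fact a) *\<^sub>R Df a 0)) \<le> (\<bar>h\<bar> ^ n * B) * measure lborel (cbox 0 (1::real))"
    using \<open>B \<ge> 0\<close> by (intro has_integral_bound[of "\<bar>h\<bar> ^ n * B"]) auto
  then show ?thesis by (simp add: Df_def)
qed

lemma prod_abs_power_le:
  fixes h :: "'a \<Rightarrow> real"
  assumes "finite E" "\<And>e. e \<in> E \<Longrightarrow> \<bar>h e\<bar> \<le> H"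
  shows "\<bar>\<Prod>e\<in>E. h e ^ \<mu> e\<bar> \<le> H ^ mabs E \<mu>"
proof -
  have "\<bar>\<Prod>e\<in>E. h e ^ \<mu> e\<bar> = (\<Prod>e\<in>E. \<bar>h e\<bar> ^ \<mu> e)"
    by (simp add: abs_prod power_abs)
  also have "\<dots> \<le> (\<Prod>e\<in>E. H ^ \<mu> e)"
    using assms by (intro prod_mono) (auto intro: power_mono)
  finally show ?thesis by (simp add: mabs_def power_sum)
qed

text \<open>A total degree below m leaves the exponents below m - |mu| for the new coordinate, which
  is the order to which a derivative of order |mu| is expanded along \<open>e\<close>. Resetting the
  value at \<open>e\<close> to \<open>undefined\<close> keeps the indices extensional.\<close>

lemma sum_multi_indices_insert:
  fixes F :: "('a \<Rightarrow> nat) \<Rightarrow> 'b::comm_monoid_add"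
  assumes "finite S" "e \<notin> S"
  shows "(\<Sum>\<mu> | \<mu> \<in> multi_indices (insert e S) \<and> mabs (insert e S) \<mu> < m. F \<mu>)
    = (\<Sum>\<mu> | \<mu> \<in> multi_indices S \<and> mabs S \<mu> < m. \<Sum>a<m - mabs S \<mu>. F (\<mu>(e := a)))"
proof -
  have cong: "mabs S (\<mu>(e := a)) = mabs S \<mu>" for \<mu> a
    unfolding mabs_def using assms(2) by (intro sum.cong) auto
  have "(\<Sum>\<mu> | \<mu> \<in> multi_indices S \<and> mabs S \<mu> < m. \<Sum>a<m - mabs S \<mu>. F (\<mu>(e := a)))
      = (\<Sum>(\<mu>, a)\<in>Sigma {\<mu>. \<mu> \<in> multi_indices S \<and> mabs S \<mu> < m} (\<lambda>\<mu>. {..<m - mabs S \<mu>}). F (\<mu>(e := a)))"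
    using finite_multi_indices_less[OF assms(1)] by (intro sum.Sigma) auto
  also have "\<dots> = (\<Sum>\<mu> | \<mu> \<in> multi_indices (insert e S) \<and> mabs (insert e S) \<mu> < m. F \<mu>)"
  proof (rule sum.reindex_bij_witness[of _ "\<lambda>\<mu>. (\<mu>(e := undefined), \<mu> e)" "\<lambda>(\<mu>, a). \<mu>(e := a)"])
    fix b assume "b \<in> {\<mu>. \<mu> \<in> multi_indices (insert e S) \<and> mabs (insert e S) \<mu> < m}"
    then have b: "b \<in> multi_indices (insert e S)" "b e + mabs S b < m"
      using assms by (auto simp: mabs_def)
    then show "(b(e := undefined), b e) \<in> Sigma {\<mu>. \<mu> \<in> multi_indices S \<and> mabs S \<mu> < m} (\<lambda>\<mu>. {..<m - mabs S \<mu>})"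
      by (auto simp: cong multi_indices_def PiE_iff extensional_def)
    show "(case (b(e := undefined), b e) of (\<mu>, a) \<Rightarrow> \<mu>(e := a)) = b"
      by simp
  next
    fix p assume "p \<in> Sigma {\<mu>. \<mu> \<in> multi_indices S \<and> mabs S \<mu> < m} (\<lambda>\<mu>. {..<m - mabs S \<mu>})"
    then obtain \<mu> a where p: "p = (\<mu>, a)" "\<mu> \<in> multi_indices S" "a < m - mabs S \<mu>"
      by blast
    then have "\<mu> e = undefined"
      using assms(2) by (auto simp: multi_indices_def PiE_iff extensional_def)
    then show "((case p of (\<mu>, a) \<Rightarrow> \<mu>(e := a))(e := undefined), (case p of (\<mu>, a) \<Rightarrow> \<mu>(e := a)) e) = p"
      by (simp add: p(1) fun_upd_idem)
    have "mabs (insert e S) (\<mu>(e := a)) = a + mabs S \<mu>"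
      using sum.insert[OF assms, of "\<mu>(e := a)"] cong[of \<mu> a] by (simp only: mabs_def fun_upd_same)
    moreover have "\<mu>(e := a) \<in> multi_indices (insert e S)"
      using p(2) by (auto simp: multi_indices_def PiE_iff extensional_def)
    ultimately show "(case p of (\<mu>, a) \<Rightarrow> \<mu>(e := a)) \<in> {\<mu>. \<mu> \<in> multi_indices (insert e S) \<and> mabs (insert e S) \<mu> < m}"
      using p by (simp del: fun_upd_apply)
    show "F (case p of (\<mu>, a) \<Rightarrow> \<mu>(e := a)) = (case p of (\<mu>, a) \<Rightarrow> F (\<mu>(e := a)))"
      by (simp add: p(1))
  qed
  finally show ?thesis ..
qed

text \<open>The coordinates are expanded one at a time, the last one of the list first. This is the order
  in which \<^const>\<open>multi_deriv\<close> composes the derivatives, so no symmetry of mixed derivatives is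
  needed.\<close>

lemma taylor_coordinatewise:
  assumes "distinct es"
  shows "\<exists>C\<ge>0. \<forall>f x h B. smooth f \<longrightarrow> 0 \<le> B \<longrightarrow>
      (\<forall>vs t. set vs \<subseteq> set es \<longrightarrow> length vs = m \<longrightarrow> (\<forall>e. 0 \<le> t e \<and> t e \<le> 1) \<longrightarrow>
        norm (foldr dir_deriv vs f (x + (\<Sum>e\<in>set es. (t e * h e) *\<^sub>R e))) \<le> B) \<longrightarrow>
      norm (f (x + (\<Sum>e\<in>set es. h e *\<^sub>R e)) -
        (\<Sum>\<mu> | \<mu> \<in> multi_indices (set es) \<and> mabs (set es) \<mu> < m.
          ((\<Prod>e\<in>set es. h e ^ \<mu> e) / mfact (set es) \<mu>) *\<^sub>R foldr (\<lambda>e. dir_deriv e ^^ \<mu> e) es f x))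
      \<le> C * (\<Sum>e\<in>set es. \<bar>h e\<bar>) ^ m * B"
  using assms
proof (induction es)
  case Nil
  \<comment> \<open>For m = 0 the Taylor sum is empty and, as 0^0 = 1, the claim is the hypothesis
    for the empty list; for m > 0 the sum is \<open>f x\<close> itself.\<close>
  have eq: "{\<mu>. \<mu> \<in> multi_indices {} \<and> mabs {} \<mu> < m} = (if m = 0 then {} else {\<lambda>_. undefined})"
    by (auto simp: multi_indices_def mabs_def)
  show ?case
    by (intro exI[of _ 1]) (auto simp: eq mfact_def power_0_left)
next
  case (Cons e es)
  define S where "S = set es"
  have S: "finite S" "e \<notin> S" "set (e # es) = insert e S"
    using Cons.prems by (auto simp: S_def)
  let ?M = "{\<mu>. \<mu> \<in> multi_indices S \<and> mabs S \<mu> < m}"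
  define G where "G \<mu> f = foldr (\<lambda>e. dir_deriv e ^^ \<mu> e) es f" for \<mu> :: "'a \<Rightarrow> nat" and f :: "'a \<Rightarrow> complex"
  define c where "c h \<mu> = (\<Prod>e\<in>S. h e ^ \<mu> e) / mfact S \<mu>" for h and \<mu> :: "'a \<Rightarrow> nat"
  have "\<exists>C\<ge>0. \<forall>f x h B. smooth f \<longrightarrow> 0 \<le> B \<longrightarrow>
      (\<forall>vs t. set vs \<subseteq> S \<longrightarrow> length vs = m \<longrightarrow> (\<forall>e. 0 \<le> t e \<and> t e \<le> 1) \<longrightarrow>
        norm (foldr dir_deriv vs f (x + (\<Sum>e\<in>S. (t e * h e) *\<^sub>R e))) \<le> B) \<longrightarrow>
      norm (f (x + (\<Sum>e\<in>S. h e *\<^sub>R e)) - (\<Sum>\<mu>\<in>?M. c h \<mu> *\<^sub>R G \<mu> f x))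
      \<le> C * (\<Sum>e\<in>S. \<bar>h e\<bar>) ^ m * B" (is "\<exists>C\<ge>0. ?P C")
    unfolding S_def G_def c_def by (rule Cons.IH) (use Cons.prems in simp)
  then obtain C where C: "C \<ge> 0" and IH: "?P C"
    by (elim exE conjE) (rule that)
  show ?case
  \<comment> \<open>\<open>C\<close> pays for the expansion in the directions of \<open>S\<close>;
    each of the \<open>card ?M\<close> derivatives occurring there is then expanded along
    \<open>e\<close> with error at most H^m B.\<close>
  proof (intro exI[of _ "C + card ?M"] conjI allI impI)
    show "0 \<le> C + card ?M" using C by simp
    fix f :: "'a \<Rightarrow> complex" and x h B
    assume f: "smooth f" and "0 \<le> B" and
      "\<forall>vs t. set vs \<subseteq> set (e # es) \<longrightarrow> length vs = m \<longrightarrow> (\<forall>e. 0 \<le> t e \<and> t e \<le> 1) \<longrightarrow>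
        norm (foldr dir_deriv vs f (x + (\<Sum>e\<in>set (e # es). (t e * h e) *\<^sub>R e))) \<le> B"
    then have B: "norm (foldr dir_deriv vs f (x + (t e * h e) *\<^sub>R e + (\<Sum>e\<in>S. (t e * h e) *\<^sub>R e))) \<le> B"
      if "set vs \<subseteq> insert e S" "length vs = m" "\<forall>e. 0 \<le> t e \<and> t e \<le> 1" for vs t
      using that unfolding S(3) by (simp add: S(1,2) add.assoc)
    define H where "H = (\<Sum>e\<in>insert e S. \<bar>h e\<bar>)"
    have H0: "0 \<le> (\<Sum>e\<in>S. \<bar>h e\<bar>)" by (simp add: sum_nonneg)
    then have HS: "(\<Sum>e\<in>S. \<bar>h e\<bar>) \<le> H" and He: "\<bar>h e\<bar> \<le> H"
      using S by (auto simp: H_def)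
    have "0 \<le> H" using He by linarith
    let ?x = "x + h e *\<^sub>R e"
    \<comment> \<open>The induction hypothesis is used at the base point already moved by the full
      step along \<open>e\<close>, hence \<open>t(e := 1)\<close> when checking the derivative
      bound.\<close>
    have A1: "norm (f (?x + (\<Sum>e\<in>S. h e *\<^sub>R e)) - (\<Sum>\<mu>\<in>?M. c h \<mu> *\<^sub>R G \<mu> f ?x)) \<le> C * (\<Sum>e\<in>S. \<bar>h e\<bar>) ^ m * B"
    proof (rule IH[rule_format, OF f \<open>0 \<le> B\<close>])
      fix vs and t :: "'a \<Rightarrow> real" assume *: "set vs \<subseteq> S" "length vs = m" "\<And>e. 0 \<le> t e \<and> t e \<le> 1"
      have "(\<Sum>e'\<in>S. ((t(e := 1)) e' * h e') *\<^sub>R e') = (\<Sum>e\<in>S. (t e * h e) *\<^sub>R e)"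
        using S(2) by (intro sum.cong) auto
      then show "norm (foldr dir_deriv vs f (?x + (\<Sum>e\<in>S. (t e * h e) *\<^sub>R e))) \<le> B"
        using B[OF subset_insertI2[OF *(1)] *(2), of "t(e := 1)"] *(3) by simp
    qed
    \<comment> \<open>The derivatives at the moved point are brought back to \<open>x\<close>.
      Expanding \<open>G \<mu> f\<close> to order m - |mu| makes the remainder a derivative of total
      order m, the list \<open>us\<close>, at a point of the box displaced along \<open>e\<close>
      only.\<close>
    have A2: "norm (G \<mu> f ?x - (\<Sum>a<m - mabs S \<mu>. (h e ^ a / fact a) *\<^sub>R (dir_deriv e ^^ a) (G \<mu> f) x))
        \<le> \<bar>h e\<bar> ^ (m - mabs S \<mu>) * B" if "\<mu> \<in> ?M" for \<mu>
    proof (rule taylor_along_line)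
      let ?vs = "concat (map (\<lambda>e. replicate (\<mu> e) e) es)"
      show "smooth (G \<mu> f)"
        unfolding G_def foldr_dir_deriv_funpow by (rule smooth_foldr_dir_deriv[OF f])
      fix t :: real assume t: "0 \<le> t" "t \<le> 1"
      define us where "us = replicate (m - mabs S \<mu>) e @ ?vs"
      have "length ?vs = mabs S \<mu>"
        using Cons.prems by (simp add: length_concat S_def mabs_def comp_def sum_list_distinct_conv_sum_set)
      then have us: "length us = m" "set us \<subseteq> insert e S"
        using that by (auto simp: us_def S_def)
      have eq: "(\<Sum>e'\<in>S. (((\<lambda>_. 0)(e := t)) e' * h e') *\<^sub>R e') = 0"
        using S(2) by (intro sum.neutral) auto
      have "(dir_deriv e ^^ (m - mabs S \<mu>)) (G \<mu> f) = foldr dir_deriv us f"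
        by (simp add: us_def G_def foldr_dir_deriv_funpow foldr_replicate)
      then show "norm ((dir_deriv e ^^ (m - mabs S \<mu>)) (G \<mu> f) (x + (t * h e) *\<^sub>R e)) \<le> B"
        using B[OF us(2,1), of "(\<lambda>_. 0)(e := t)"] t unfolding eq by simp
    qed
    have cH: "\<bar>c h \<mu>\<bar> \<le> H ^ mabs S \<mu>" for \<mu>
    proof -
      have "\<bar>h e\<bar> \<le> H" if "e \<in> S" for e
        using that HS member_le_sum[of e S "\<lambda>e. \<bar>h e\<bar>"] S(1) by simp
      then have "\<bar>\<Prod>e\<in>S. h e ^ \<mu> e\<bar> \<le> H ^ mabs S \<mu>"
        by (intro prod_abs_power_le S(1))
      moreover have "1 \<le> mfact S \<mu>"
        unfolding mfact_def by (intro prod_ge_1) (simp add: fact_ge_1)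
      then have "\<bar>c h \<mu>\<bar> \<le> \<bar>\<Prod>e\<in>S. h e ^ \<mu> e\<bar>"
        using divide_left_mono[of 1 "mfact S \<mu>" "\<bar>\<Prod>e\<in>S. h e ^ \<mu> e\<bar>"] by (simp add: c_def)
      ultimately show ?thesis by linarith
    qed
    have "(\<Sum>\<mu> | \<mu> \<in> multi_indices (insert e S) \<and> mabs (insert e S) \<mu> < m.
          ((\<Prod>e\<in>insert e S. h e ^ \<mu> e) / mfact (insert e S) \<mu>) *\<^sub>R (dir_deriv e ^^ \<mu> e) (G \<mu> f) x)
      = (\<Sum>\<mu>\<in>?M. \<Sum>a<m - mabs S \<mu>. c h \<mu> *\<^sub>R (h e ^ a / fact a) *\<^sub>R (dir_deriv e ^^ a) (G \<mu> f) x)"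
      unfolding sum_multi_indices_insert[OF S(1,2)]
    proof (intro sum.cong refl)
      fix \<mu> :: "'a \<Rightarrow> nat" and a :: nat
      have "G (\<mu>(e := a)) f = G \<mu> f"
        unfolding G_def using S(2) by (intro foldr_cong refl) (auto simp: S_def)
      moreover have "(\<Prod>e'\<in>insert e S. h e' ^ (\<mu>(e := a)) e') = h e ^ a * (\<Prod>e\<in>S. h e ^ \<mu> e)"
      proof -
        have "(\<Prod>e'\<in>S. h e' ^ (\<mu>(e := a)) e') = (\<Prod>e\<in>S. h e ^ \<mu> e)"
          using S(2) by (intro prod.cong) auto
        then show ?thesis
          by (simp only: prod.insert[OF S(1,2)] fun_upd_same)
      qed
      moreover have "mfact (insert e S) (\<mu>(e := a)) = fact a * mfact S \<mu>"
      proof -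
        have "(\<Prod>e'\<in>S. fact ((\<mu>(e := a)) e') :: real) = (\<Prod>e\<in>S. fact (\<mu> e))"
          using S(2) by (intro prod.cong) auto
        then show ?thesis
          by (simp only: mfact_def prod.insert[OF S(1,2)] fun_upd_same)
      qed
      ultimately show "((\<Prod>e'\<in>insert e S. h e' ^ (\<mu>(e := a)) e') / mfact (insert e S) (\<mu>(e := a))) *\<^sub>R
          (dir_deriv e ^^ (\<mu>(e := a)) e) (G (\<mu>(e := a)) f) x
          = c h \<mu> *\<^sub>R (h e ^ a / fact a) *\<^sub>R (dir_deriv e ^^ a) (G \<mu> f) x"
        by (simp only: fun_upd_same c_def scaleR_scaleR times_divide_times_eq mult.commute)
    qed
    then have T: "(\<Sum>\<mu> | \<mu> \<in> multi_indices (insert e S) \<and> mabs (insert e S) \<mu> < m.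
          ((\<Prod>e\<in>insert e S. h e ^ \<mu> e) / mfact (insert e S) \<mu>) *\<^sub>R (dir_deriv e ^^ \<mu> e) (G \<mu> f) x)
      = (\<Sum>\<mu>\<in>?M. c h \<mu> *\<^sub>R (\<Sum>a<m - mabs S \<mu>. (h e ^ a / fact a) *\<^sub>R (dir_deriv e ^^ a) (G \<mu> f) x))"
      (is "_ = ?T") by (simp only: scaleR_sum_right)
    have "norm ((\<Sum>\<mu>\<in>?M. c h \<mu> *\<^sub>R G \<mu> f ?x) - ?T)
        = norm (\<Sum>\<mu>\<in>?M. c h \<mu> *\<^sub>R (G \<mu> f ?x - (\<Sum>a<m - mabs S \<mu>. (h e ^ a / fact a) *\<^sub>R (dir_deriv e ^^ a) (G \<mu> f) x)))"
      by (simp only: scaleR_diff_right sum_subtractf)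
    also have "\<dots> \<le> (\<Sum>\<mu>\<in>?M. H ^ m * B)"
    proof (rule sum_norm_le)
      fix \<mu> assume \<mu>: "\<mu> \<in> ?M"
      have "norm (c h \<mu> *\<^sub>R (G \<mu> f ?x - (\<Sum>a<m - mabs S \<mu>. (h e ^ a / fact a) *\<^sub>R (dir_deriv e ^^ a) (G \<mu> f) x)))
          \<le> H ^ mabs S \<mu> * (\<bar>h e\<bar> ^ (m - mabs S \<mu>) * B)"
        unfolding norm_scaleR using A2[OF \<mu>] cH \<open>0 \<le> H\<close> by (intro mult_mono) auto
      also have "\<dots> \<le> H ^ mabs S \<mu> * (H ^ (m - mabs S \<mu>) * B)"
        using He \<open>0 \<le> H\<close> \<open>0 \<le> B\<close> by (intro mult_left_mono mult_right_mono power_mono) auto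
      also have "\<dots> = H ^ m * B"
        using \<mu> by (simp add: mult.assoc[symmetric] power_add[symmetric])
      finally show "norm (c h \<mu> *\<^sub>R (G \<mu> f ?x - (\<Sum>a<m - mabs S \<mu>. (h e ^ a / fact a) *\<^sub>R (dir_deriv e ^^ a) (G \<mu> f) x)))
          \<le> H ^ m * B" .
    qed
    also have "\<dots> = card ?M * H ^ m * B" by simp
    finally have A3: "norm ((\<Sum>\<mu>\<in>?M. c h \<mu> *\<^sub>R G \<mu> f ?x) - ?T) \<le> card ?M * H ^ m * B" .
    have "C * (\<Sum>e\<in>S. \<bar>h e\<bar>) ^ m * B \<le> C * H ^ m * B"
      using C HS H0 \<open>0 \<le> B\<close> by (intro mult_left_mono mult_right_mono power_mono) auto
    from norm_diff_triangle_le[OF order_trans[OF A1 this] A3]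
    have "norm (f (?x + (\<Sum>e\<in>S. h e *\<^sub>R e)) - ?T) \<le> (C + card ?M) * H ^ m * B"
      by (simp only: distrib_right)
    then show "norm (f (x + (\<Sum>e\<in>set (e # es). h e *\<^sub>R e)) -
        (\<Sum>\<mu> | \<mu> \<in> multi_indices (set (e # es)) \<and> mabs (set (e # es)) \<mu> < m.
          ((\<Prod>e\<in>set (e # es). h e ^ \<mu> e) / mfact (set (e # es)) \<mu>) *\<^sub>R foldr (\<lambda>e. dir_deriv e ^^ \<mu> e) (e # es) f x))
      \<le> (C + card ?M) * (\<Sum>e\<in>set (e # es). \<bar>h e\<bar>) ^ m * B"
      unfolding S(3) foldr_Cons o_apply G_def[symmetric] H_def[symmetric] T
      by (simp only: sum.insert[OF S(1,2)] add.assoc)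
  qed
qed

section \<open>Decay of Schwartz functions and the Taylor remainder\<close>

lemma one_plus_power_le:
  fixes a :: real
  assumes "a \<ge> 0"
  shows "(1 + a) ^ M \<le> 2 ^ M * (1 + a ^ M)"
proof (cases "a \<le> 1")
  case True
  then have "(1 + a) ^ M \<le> 2 ^ M"
    using assms by (intro power_mono) auto
  also have "\<dots> \<le> 2 ^ M * (1 + a ^ M)"
    using assms by simp
  finally show ?thesis .
next
  case False
  then have "(1 + a) ^ M \<le> (2 * a) ^ M"
    using assms by (intro power_mono) auto
  also have "\<dots> \<le> 2 ^ M * (1 + a ^ M)"
    by (simp add: power_mult_distrib)
  finally show ?thesis .
qed

text \<open>The sum is at most \<open>card E\<close> times its largest term, whose power is one of
  the summands on the right. Even exponents remove the absolute values, so that central moments of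
  single coordinates suffice for the remainder.\<close>

lemma sum_abs_power_even_le:
  fixes h :: "'a \<Rightarrow> real"
  assumes "finite E" "k > 0"
  shows "(\<Sum>e\<in>E. \<bar>h e\<bar>) ^ (2 * k) \<le> real (card E) ^ (2 * k) * (\<Sum>e\<in>E. h e ^ (2 * k))"
proof (cases "E = {}")
  case True
  then show ?thesis using assms(2) by (simp add: zero_power)
next
  case False
  define m where "m = Max ((\<lambda>e. \<bar>h e\<bar>) ` E)"
  have m: "m \<in> (\<lambda>e. \<bar>h e\<bar>) ` E" "\<And>e. e \<in> E \<Longrightarrow> \<bar>h e\<bar> \<le> m"
    using False assms(1) by (auto simp: m_def)
  then obtain e0 where e0: "e0 \<in> E" "m = \<bar>h e0\<bar>" by blast
  have "(\<Sum>e\<in>E. \<bar>h e\<bar>) \<le> real (card E) * m"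
    using sum_bounded_above[of E "\<lambda>e. \<bar>h e\<bar>" m] m(2) by simp
  then have "(\<Sum>e\<in>E. \<bar>h e\<bar>) ^ (2 * k) \<le> (real (card E) * m) ^ (2 * k)"
    by (intro power_mono sum_nonneg) auto
  also have "\<dots> = real (card E) ^ (2 * k) * h e0 ^ (2 * k)"
    by (simp add: power_mult_distrib e0(2) power_even_abs)
  also have "h e0 ^ (2 * k) \<le> (\<Sum>e\<in>E. h e ^ (2 * k))"
    using e0(1) assms(1) by (intro member_le_sum) auto
  finally show ?thesis by (simp add: mult_left_mono)
qed

text \<open>Coordinates are bounded by the ambient norm, and the powers 0 and M of that norm control
  the whole weight.\<close>

lemma schwartz_decay:
  fixes E :: "'a::real_normed_vector set"
  assumes "finite E" "independent E" "span E = UNIV" "\<phi> \<in> schwartz"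
  obtains B where "B \<ge> 0"
    "\<And>w. norm (foldr dir_deriv vs \<phi> w) * (1 + (\<Sum>e\<in>E. \<bar>representation E w e\<bar>)) ^ M \<le> B"
proof -
  obtain c where c: "c > 0" "\<And>x. (\<Sum>e\<in>E. \<bar>representation E x e\<bar>) \<le> c * norm x"
    using sum_abs_representation_le[OF assms(1-3)] by blast
  have bdd: "bounded (range (\<lambda>x. norm x ^ k *\<^sub>R foldr dir_deriv vs \<phi> x))" for k
    using assms(4) unfolding schwartz_def by blast
  obtain b0 where b0: "\<And>w. norm (norm w ^ 0 *\<^sub>R foldr dir_deriv vs \<phi> w) \<le> b0"
    using bdd[of 0] unfolding bounded_iff by blast
  obtain bM where bM: "\<And>w. norm (norm w ^ M *\<^sub>R foldr dir_deriv vs \<phi> w) \<le> bM"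
    using bdd[of M] unfolding bounded_iff by blast
  show ?thesis
  proof (rule that)
    have "0 \<le> b0" "0 \<le> bM"
      using order_trans[OF norm_ge_zero b0] order_trans[OF norm_ge_zero bM] by blast+
    then show "0 \<le> 2 ^ M * (b0 + c ^ M * bM)"
      using c(1) by simp
    fix w
    let ?F = "norm (foldr dir_deriv vs \<phi> w)"
    have "(1 + (\<Sum>e\<in>E. \<bar>representation E w e\<bar>)) ^ M \<le> (1 + c * norm w) ^ M"
      using c(2)[of w] by (intro power_mono add_left_mono add_nonneg_nonneg sum_nonneg) auto
    also have "\<dots> \<le> 2 ^ M * (1 + (c * norm w) ^ M)"
      using c(1) by (intro one_plus_power_le) simp
    finally have "?F * (1 + (\<Sum>e\<in>E. \<bar>representation E w e\<bar>)) ^ M \<le> ?F * (2 ^ M * (1 + (c * norm w) ^ M))"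
      by (intro mult_left_mono) auto
    also have "\<dots> = 2 ^ M * (?F + c ^ M * (norm w ^ M * ?F))"
      by (simp add: algebra_simps power_mult_distrib)
    also have "\<dots> \<le> 2 ^ M * (b0 + c ^ M * bM)"
      using b0[of w] bM[of w] c(1) by (intro mult_left_mono add_mono) auto
    finally show "?F * (1 + (\<Sum>e\<in>E. \<bar>representation E w e\<bar>)) ^ M \<le> 2 ^ M * (b0 + c ^ M * bM)" .
  qed
qed

lemma schwartz_decay_uniform:
  fixes E :: "'a::real_normed_vector set"
  assumes "finite E" "independent E" "span E = UNIV" "\<phi> \<in> schwartz"
  obtains B where "B \<ge> 0"
    "\<And>vs w. set vs \<subseteq> E \<Longrightarrow> length vs = m \<Longrightarrow>
      norm (foldr dir_deriv vs \<phi> w) * (1 + (\<Sum>e\<in>E. \<bar>representation E w e\<bar>)) ^ M \<le> B"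
proof -
  have "\<forall>vs. \<exists>B\<ge>0. \<forall>w. norm (foldr dir_deriv vs \<phi> w) * (1 + (\<Sum>e\<in>E. \<bar>representation E w e\<bar>)) ^ M \<le> B"
    using schwartz_decay[OF assms] by metis
  then obtain b where b: "\<And>vs. b vs \<ge> 0"
    "\<And>vs w. norm (foldr dir_deriv vs \<phi> w) * (1 + (\<Sum>e\<in>E. \<bar>representation E w e\<bar>)) ^ M \<le> b vs"
    by metis
  let ?L = "{vs. set vs \<subseteq> E \<and> length vs = m}"
  have fin: "finite ?L"
    using finite_lists_length_eq[OF assms(1)] .
  show ?thesis
  proof (rule that)
    show "0 \<le> sum b ?L" using b(1) by (simp add: sum_nonneg)
    fix vs w assume "set vs \<subseteq> E" "length vs = m"
    then have "b vs \<le> sum b ?L"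
      using fin b(1) by (intro member_le_sum) auto
    then show "norm (foldr dir_deriv vs \<phi> w) * (1 + (\<Sum>e\<in>E. \<bar>representation E w e\<bar>)) ^ M \<le> sum b ?L"
      using b(2) order_trans by blast
  qed
qed

lemma representation_add_combination:
  assumes "finite E" "independent E" "span E = UNIV" "e \<in> E"
  shows "representation E (x + (\<Sum>e\<in>E. u e *\<^sub>R e)) e = representation E x e + u e"
proof -
  have "representation E (\<Sum>e\<in>E. u e *\<^sub>R e) e = (\<Sum>e'\<in>E. u e' * (if e = e' then 1 else 0))"
    using assms by (simp add: representation_sum representation_scale representation_basis)
  also have "\<dots> = u e"
    using assms(1,4) by (subst sum.remove[of _ e]) (auto intro!: sum.neutral split: if_splits)
  finally show ?thesis
    using assms by (simp add: representation_add)
qed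

text \<open>The weight is moved from the intermediate points of the Taylor remainder to the base point
  by Peetre's inequality \<open>1 + |x| \<le> (1 + |w|) (1 + |w - x|)\<close>.\<close>

lemma schwartz_taylor_remainder:
  fixes E :: "'a::real_normed_vector set"
  assumes E: "finite E" "independent E" "span E = UNIV" and \<phi>: "\<phi> \<in> schwartz"
  obtains C where "C \<ge> 0"
    "\<And>x h. norm (\<phi> (x + (\<Sum>e\<in>E. h e *\<^sub>R e)) -
        (\<Sum>\<mu> | \<mu> \<in> multi_indices E \<and> mabs E \<mu> < m.
          ((\<Prod>e\<in>E. h e ^ \<mu> e) / mfact E \<mu>) *\<^sub>R multi_deriv E \<mu> \<phi> x))
      \<le> C * (\<Sum>e\<in>E. \<bar>h e\<bar>) ^ m * (1 + (\<Sum>e\<in>E. \<bar>h e\<bar>)) ^ M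
          / (1 + (\<Sum>e\<in>E. \<bar>representation E x e\<bar>)) ^ M"
proof -
  \<comment> \<open>The list has to be the very one chosen inside \<open>multi_deriv\<close>, so
    that the expansion is literally in terms of that operator.\<close>
  define es where "es = (SOME es. distinct es \<and> set es = E)"
  have "\<exists>es. distinct es \<and> set es = E"
    using finite_distinct_list[OF E(1)] by blast
  then have es: "distinct es" "set es = E"
    using someI_ex[of "\<lambda>es. distinct es \<and> set es = E"] unfolding es_def by blast+
  obtain B where B: "B \<ge> 0"
    "\<And>vs w. set vs \<subseteq> E \<Longrightarrow> length vs = m \<Longrightarrow>
      norm (foldr dir_deriv vs \<phi> w) * (1 + (\<Sum>e\<in>E. \<bar>representation E w e\<bar>)) ^ M \<le> B"
    using schwartz_decay_uniform[OF E \<phi>] by blast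
  have sm: "smooth \<phi>" using \<phi> by (simp add: schwartz_def)
  from taylor_coordinatewise[OF es(1), of m, unfolded es(2)] obtain C where "C \<ge> 0"
    and C: "\<forall>f x h B. smooth f \<longrightarrow> 0 \<le> B \<longrightarrow>
      (\<forall>vs t. set vs \<subseteq> E \<longrightarrow> length vs = m \<longrightarrow> (\<forall>e. 0 \<le> t e \<and> t e \<le> 1) \<longrightarrow>
        norm (foldr dir_deriv vs f (x + (\<Sum>e\<in>E. (t e * h e) *\<^sub>R e))) \<le> B) \<longrightarrow>
      norm (f (x + (\<Sum>e\<in>E. h e *\<^sub>R e)) -
        (\<Sum>\<mu> | \<mu> \<in> multi_indices E \<and> mabs E \<mu> < m.
          ((\<Prod>e\<in>E. h e ^ \<mu> e) / mfact E \<mu>) *\<^sub>R foldr (\<lambda>e. dir_deriv e ^^ \<mu> e) es f x))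
      \<le> C * (\<Sum>e\<in>E. \<bar>h e\<bar>) ^ m * B"
    by (elim exE conjE) (rule that)
  show ?thesis
  proof (rule that)
    show "0 \<le> C * B" using \<open>C \<ge> 0\<close> B(1) by simp
    fix x and h :: "'a \<Rightarrow> real"
    define H where "H = (\<Sum>e\<in>E. \<bar>h e\<bar>)"
    define X where "X = (\<Sum>e\<in>E. \<bar>representation E x e\<bar>)"
    have H0: "0 \<le> H" and X0: "0 \<le> X"
      by (simp_all add: H_def X_def sum_nonneg)
    \<comment> \<open>A bound for the derivatives of order m on the whole box between x and x + h.
      It may depend on x and h, because the constant of \<open>taylor_coordinatewise\<close> is
      chosen before them.\<close>
    define B' where "B' = B * (1 + H) ^ M / (1 + X) ^ M"
    have "0 \<le> B'" using B(1) H0 X0 by (simp add: B'_def)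
    have bound: "norm (foldr dir_deriv vs \<phi> (x + (\<Sum>e\<in>E. (t e * h e) *\<^sub>R e))) \<le> B'"
      if vs: "set vs \<subseteq> E" "length vs = m" and t: "\<And>e. 0 \<le> t e \<and> t e \<le> 1" for vs t
    proof -
      define w where "w = x + (\<Sum>e\<in>E. (t e * h e) *\<^sub>R e)"
      define W where "W = (\<Sum>e\<in>E. \<bar>representation E w e\<bar>)"
      have W0: "0 \<le> W" by (simp add: W_def sum_nonneg)
      have "\<bar>representation E x e\<bar> \<le> \<bar>representation E w e\<bar> + \<bar>h e\<bar>" if "e \<in> E" for e
      proof -
        have "\<bar>t e * h e\<bar> \<le> \<bar>h e\<bar>"
          using t[of e] by (simp add: abs_mult mult_left_le_one_le)
        then show ?thesis
          unfolding w_def representation_add_combination[OF E that] by linarith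
      qed
      then have "X \<le> W + H"
        unfolding X_def W_def H_def sum.distrib[symmetric] by (intro sum_mono)
      moreover have "0 \<le> W * H" using W0 H0 by simp
      ultimately have "1 + X \<le> (1 + W) * (1 + H)"
        by (simp add: algebra_simps)
      then have "(1 + X) ^ M \<le> (1 + W) ^ M * (1 + H) ^ M"
        unfolding power_mult_distrib[symmetric] using X0 by (intro power_mono) auto
      then have "norm (foldr dir_deriv vs \<phi> w) * (1 + X) ^ M
          \<le> norm (foldr dir_deriv vs \<phi> w) * ((1 + W) ^ M * (1 + H) ^ M)"
        by (intro mult_left_mono) auto
      also have "\<dots> \<le> B * (1 + H) ^ M"
        unfolding mult.assoc[symmetric] using B(2)[OF vs, of w] H0
        by (intro mult_right_mono) (auto simp: W_def)
      finally show ?thesis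
        using X0 by (simp add: B'_def w_def pos_le_divide_eq)
    qed
    have "norm (\<phi> (x + (\<Sum>e\<in>E. h e *\<^sub>R e)) -
        (\<Sum>\<mu> | \<mu> \<in> multi_indices E \<and> mabs E \<mu> < m.
          ((\<Prod>e\<in>E. h e ^ \<mu> e) / mfact E \<mu>) *\<^sub>R foldr (\<lambda>e. dir_deriv e ^^ \<mu> e) es \<phi> x))
      \<le> C * (\<Sum>e\<in>E. \<bar>h e\<bar>) ^ m * B'"
      by (rule C[rule_format, OF sm \<open>0 \<le> B'\<close>], rule bound) auto
    then show "norm (\<phi> (x + (\<Sum>e\<in>E. h e *\<^sub>R e)) -
        (\<Sum>\<mu> | \<mu> \<in> multi_indices E \<and> mabs E \<mu> < m.
          ((\<Prod>e\<in>E. h e ^ \<mu> e) / mfact E \<mu>) *\<^sub>R multi_deriv E \<mu> \<phi> x))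
      \<le> C * B * (\<Sum>e\<in>E. \<bar>h e\<bar>) ^ m * (1 + (\<Sum>e\<in>E. \<bar>h e\<bar>)) ^ M
          / (1 + (\<Sum>e\<in>E. \<bar>representation E x e\<bar>)) ^ M"
      by (simp add: multi_deriv_def es_def[symmetric] B'_def H_def[symmetric] X_def[symmetric] mult_ac)
  qed
qed

section \<open>The Szasz kernel and the polynomials \<open>J\<^sub>\<mu>\<close>\<close>

text \<open>The index set is a box, so the sum of products factorises. Hence \<open>J_poly\<close>
  is the joint central moment of independent Poisson variables.\<close>

lemma J_poly_eq_prod:
  assumes "finite E"
  shows "J_poly E \<mu> x = (\<Prod>e\<in>E. central_moment (\<mu> e) (representation E x e))"
proof -
  have "{\<nu>. \<nu> \<in> multi_indices E \<and> (\<forall>e\<in>E. \<nu> e \<le> \<mu> e div 2)} = PiE E (\<lambda>e. {..\<mu> e div 2})"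
    by (auto simp: multi_indices_def PiE_def)
  then show ?thesis
    by (simp add: J_poly_def central_moment_def p_multi_def mpow_def prod_sum_PiE assms prod.distrib)
qed

lemma poly_degree_le_J_poly:
  assumes "finite E"
  shows "poly_degree_le E (mabs E \<mu> div 2) (J_poly E \<mu>)"
  unfolding poly_degree_le_def
proof (intro exI allI)
  fix x
  let ?A = "{\<nu>. \<nu> \<in> multi_indices E \<and> (\<forall>e\<in>E. \<nu> e \<le> \<mu> e div 2)}"
  let ?B = "{\<nu>. \<nu> \<in> multi_indices E \<and> mabs E \<nu> \<le> mabs E \<mu> div 2}"
  have "finite ?B"
    using finite_multi_indices_less[OF assms, of "Suc (mabs E \<mu> div 2)"] by (simp add: less_Suc_eq_le)
  moreover have "?A \<subseteq> ?B"
  proof safe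
    fix \<nu> assume "\<forall>e\<in>E. \<nu> e \<le> \<mu> e div 2"
    then have "\<forall>e\<in>E. 2 * \<nu> e \<le> \<mu> e" by auto
    then have "2 * mabs E \<nu> \<le> mabs E \<mu>"
      unfolding mabs_def sum_distrib_left by (intro sum_mono) auto
    then show "mabs E \<nu> \<le> mabs E \<mu> div 2" by linarith
  qed
  ultimately show "J_poly E \<mu> x = (\<Sum>\<nu>\<in>?B.
      (if \<forall>e\<in>E. \<nu> e \<le> \<mu> e div 2 then p_multi E \<mu> \<nu> else 0) * mpow E x \<nu>)"
    unfolding J_poly_def by (intro sum.mono_neutral_cong_left) auto
qed

lemma szasz_kernel_eq_prod:
  assumes "finite E"
  shows "szasz_kernel E \<gamma> x = (\<Prod>e\<in>E. poisson_weight (representation E x e) (\<gamma> e))"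
  by (simp add: szasz_kernel_def poisson_weight_def mpow_def mfact_def prod.distrib prod_dividef
      exp_sum assms flip: sum_negf)

text \<open>The kernel at Nx is a product of Poisson weights of means N x(e), and gamma/N - x =
  (gamma - Nx)/N accounts for the power of N.\<close>

lemma has_sum_szasz_kernel_moment:
  fixes E :: "'a::real_vector set"
  assumes E: "finite E" "independent E" "span E = UNIV"
    and x: "\<And>e. e \<in> E \<Longrightarrow> representation E x e \<ge> 0" and "N \<ge> 1"
  shows "((\<lambda>\<gamma>. szasz_kernel E \<gamma> (real N *\<^sub>R x) * (\<Prod>e\<in>E. (real (\<gamma> e) / real N - representation E x e) ^ \<mu> e))
    has_sum J_poly E \<mu> (real N *\<^sub>R x) / real N ^ mabs E \<mu>) (multi_indices E)"
proof -
  let ?y = "\<lambda>e. representation E (real N *\<^sub>R x) e"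
  have y: "?y e = real N * representation E x e" for e
    using E by (simp add: representation_scale)
  have "((\<lambda>\<gamma>. \<Prod>e\<in>E. poisson_weight (?y e) (\<gamma> e) * (real (\<gamma> e) - ?y e) ^ \<mu> e)
    has_sum (\<Prod>e\<in>E. central_moment (\<mu> e) (?y e))) (multi_indices E)"
    unfolding multi_indices_def using x
    by (intro has_sum_prod_PiE has_sum_poisson_central_moment E) (simp add: y)
  then have "((\<lambda>\<gamma>. (\<Prod>e\<in>E. poisson_weight (?y e) (\<gamma> e) * (real (\<gamma> e) - ?y e) ^ \<mu> e) / real N ^ mabs E \<mu>)
    has_sum J_poly E \<mu> (real N *\<^sub>R x) / real N ^ mabs E \<mu>) (multi_indices E)"
    unfolding J_poly_eq_prod[OF E(1)] by (rule has_sum_divide_const)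
  moreover have "(\<Prod>e\<in>E. poisson_weight (?y e) (\<gamma> e) * (real (\<gamma> e) - ?y e) ^ \<mu> e) / real N ^ mabs E \<mu>
    = szasz_kernel E \<gamma> (real N *\<^sub>R x) * (\<Prod>e\<in>E. (real (\<gamma> e) / real N - representation E x e) ^ \<mu> e)" for \<gamma>
  proof -
    have "(\<Prod>e\<in>E. (real (\<gamma> e) / real N - representation E x e) ^ \<mu> e)
        = (\<Prod>e\<in>E. (real (\<gamma> e) - ?y e) ^ \<mu> e / real N ^ \<mu> e)"
      using \<open>N \<ge> 1\<close> by (intro prod.cong refl) (simp add: y power_divide[symmetric] diff_divide_distrib)
    then show ?thesis
      by (simp add: szasz_kernel_eq_prod[OF E(1)] prod.distrib prod_dividef mabs_def power_sum)
  qed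
  ultimately show ?thesis by simp
qed

lemma szasz_kernel_nonneg:
  assumes "finite E" "independent E" "span E = UNIV"
    and "\<And>e. e \<in> E \<Longrightarrow> representation E x e \<ge> 0"
  shows "szasz_kernel E \<gamma> (real N *\<^sub>R x) \<ge> 0"
  unfolding szasz_kernel_eq_prod[OF assms(1)] using assms
  by (intro prod_nonneg poisson_weight_nonneg ballI) (simp add: representation_scale)

text \<open>The case of an index supported at \<open>e\<close>; the other coordinates contribute
  zeroth moments, equal to 1.\<close>

lemma has_sum_szasz_kernel_coordinate_moment:
  fixes E :: "'a::real_vector set"
  assumes E: "finite E" "independent E" "span E = UNIV"
    and x: "\<And>e. e \<in> E \<Longrightarrow> representation E x e \<ge> 0" and N: "N \<ge> 1" and e: "e \<in> E"
  shows "((\<lambda>\<gamma>. szasz_kernel E \<gamma> (real N *\<^sub>R x) * (real (\<gamma> e) / real N - representation E x e) ^ k)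
    has_sum central_moment k (real N * representation E x e) / real N ^ k) (multi_indices E)"
proof -
  let ?\<mu> = "\<lambda>e'. if e' = e then k else 0"
  have cm: "central_moment 0 y = 1" for y
    by (simp add: central_moment_def p_coeff_def)
  have single: "(\<Prod>e'\<in>E. if e' = e then F e' else 1) = F e" for F :: "'a \<Rightarrow> real"
    using E(1) e by simp
  have "(\<Prod>e'\<in>E. f e' ^ ?\<mu> e') = f e ^ k" for f :: "'a \<Rightarrow> real"
    using single[of "\<lambda>e'. f e' ^ k"] by (simp add: if_distrib cong: if_cong)
  moreover have "mabs E ?\<mu> = k"
    using E(1) e by (simp add: mabs_def)
  moreover have "J_poly E ?\<mu> (real N *\<^sub>R x) = central_moment k (real N * representation E x e)"
  proof -
    have "J_poly E ?\<mu> (real N *\<^sub>R x)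
        = (\<Prod>e'\<in>E. if e' = e then central_moment k (representation E (real N *\<^sub>R x) e') else 1)"
      unfolding J_poly_eq_prod[OF E(1)] by (intro prod.cong refl) (simp add: cm)
    then show ?thesis
      unfolding single using E by (simp add: representation_scale)
  qed
  ultimately show ?thesis
    using has_sum_szasz_kernel_moment[OF E x N, of ?\<mu>] by simp
qed

text \<open>For N >= 1 one has 1 + Ny <= N(1 + X), so N^k in the numerator cancels half of
  N^(2k).\<close>

lemma szasz_kernel_even_moment_bound:
  obtains C where "C > 0" "\<And>N y X. N \<ge> 1 \<Longrightarrow> 0 \<le> y \<Longrightarrow> y \<le> X \<Longrightarrow>
    central_moment (2 * k) (real N * y) / real N ^ (2 * k) \<le> C * (1 + X) ^ k / real N ^ k"
proof -
  obtain C where C: "C > 0" "\<And>x. x \<ge> 0 \<Longrightarrow> \<bar>central_moment (2 * k) x\<bar> \<le> C * (1 + x) ^ k"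
    using central_moment_even_bound by blast
  have "central_moment (2 * k) (real N * y) / real N ^ (2 * k) \<le> C * (1 + X) ^ k / real N ^ k"
    if "N \<ge> 1" "0 \<le> y" "y \<le> X" for N and y X :: real
  proof -
    have N: "real N \<ge> 1" using that(1) by simp
    have "1 + real N * y \<le> real N * (1 + X)"
      using N that mult_left_mono[of y X "real N"] unfolding distrib_left by linarith
    then have "(1 + real N * y) ^ k \<le> (real N * (1 + X)) ^ k"
      using that by (intro power_mono) auto
    then have "C * (1 + real N * y) ^ k \<le> C * (real N * (1 + X)) ^ k"
      using C(1) by simp
    moreover have "central_moment (2 * k) (real N * y) \<le> C * (1 + real N * y) ^ k"
      using C(2)[of "real N * y"] that by simp
    ultimately have "central_moment (2 * k) (real N * y) \<le> C * (real N * (1 + X)) ^ k"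
      by linarith
    then have "central_moment (2 * k) (real N * y) / real N ^ (2 * k)
        \<le> C * (real N * (1 + X)) ^ k / real N ^ (2 * k)"
      by (intro divide_right_mono) auto
    also have "\<dots> = C * (1 + X) ^ k / real N ^ k"
      using N by (simp add: power_mult_distrib mult_2 power_add)
    finally show ?thesis .
  qed
  with C(1) that show ?thesis by blast
qed

section \<open>The asymptotic expansion of the Szasz function\<close>

theorem proposition2p6:
  fixes \<Lambda> E :: "'a::real_normed_vector set" and \<phi> :: "'a \<Rightarrow> complex"
    and r :: nat and K :: real
  assumes "is_lattice \<Lambda>" and "integral_basis E \<Lambda>"
    and "\<phi> \<in> schwartz"
    and "r > 0" and "K > 0" and "real r < K" and "K < 2 * real r"
  shows "(\<exists>C>0. \<exists>S :: nat \<Rightarrow> 'a \<Rightarrow> complex. \<forall>x\<in>orthant E. \<forall>N\<ge>1.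
           szasz E N \<phi> x =
             (\<Sum>\<mu> | \<mu> \<in> multi_indices E \<and> mabs E \<mu> \<le> 2 * r - 1.
                (J_poly E \<mu> (real N *\<^sub>R x) / (mfact E \<mu> * real N ^ mabs E \<mu>)) *\<^sub>R
                  multi_deriv E \<mu> \<phi> x)
             + S N x \<and>
           norm (S N x) \<le> C * real N powr (- real r) * (1 + coord_norm E x) powr (real r - K))
         \<and> (\<forall>\<mu>\<in>multi_indices E. poly_degree_le E (mabs E \<mu> div 2) (J_poly E \<mu>))"
proof -
  note E = integral_basis_is_basis[OF assms(1,2)]
  \<comment> \<open>The strict form of |mu| <= 2r - 1, equivalent because r > 0.\<close>
  let ?M = "{\<mu>. \<mu> \<in> multi_indices E \<and> mabs E \<mu> < 2 * r}"
  define P where "P N x = (\<Sum>\<mu>\<in>?M. (J_poly E \<mu> (real N *\<^sub>R x) / (mfact E \<mu> * real N ^ mabs E \<mu>)) *\<^sub>R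
      multi_deriv E \<mu> \<phi> x)" for N x
  obtain C where "C \<ge> 0" and C: "\<And>x h. norm (\<phi> (x + (\<Sum>e\<in>E. h e *\<^sub>R e)) -
        (\<Sum>\<mu>\<in>?M. ((\<Prod>e\<in>E. h e ^ \<mu> e) / mfact E \<mu>) *\<^sub>R multi_deriv E \<mu> \<phi> x))
      \<le> C * (\<Sum>e\<in>E. \<bar>h e\<bar>) ^ (2 * r) * (1 + (\<Sum>e\<in>E. \<bar>h e\<bar>)) ^ (4 * r)
          / (1 + (\<Sum>e\<in>E. \<bar>representation E x e\<bar>)) ^ (4 * r)"
    using schwartz_taylor_remainder[OF E assms(3), of "2 * r" "4 * r"] by blast
  obtain c1 where c1: "c1 > 0" "\<And>N y X. N \<ge> 1 \<Longrightarrow> 0 \<le> y \<Longrightarrow> y \<le> X \<Longrightarrow>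
      central_moment (2 * r) (real N * y) / real N ^ (2 * r) \<le> c1 * (1 + X) ^ r / real N ^ r"
    using szasz_kernel_even_moment_bound[of r] by blast
  obtain c2 where c2: "c2 > 0" "\<And>N y X. N \<ge> 1 \<Longrightarrow> 0 \<le> y \<Longrightarrow> y \<le> X \<Longrightarrow>
      central_moment (2 * (3 * r)) (real N * y) / real N ^ (2 * (3 * r)) \<le> c2 * (1 + X) ^ (3 * r) / real N ^ (3 * r)"
    using szasz_kernel_even_moment_bound[of "3 * r"] by blast
  obtain b where b: "\<And>w. norm (\<phi> w) \<le> b"
    using schwartz_decay[OF E assms(3), of "[]" 0] by auto
  \<comment> \<open>\<open>A\<close> collects the Taylor constant, the factor from splitting
    (1+H)^(4r), and the powers of \<open>card E\<close> from passing to single coordinates. The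
    summand 1 in \<open>D\<close> keeps the constant positive when \<open>A\<close> or
    \<open>d\<close> is zero.\<close>
  define d where "d = real (card E)"
  define A where "A = C * 2 ^ (4 * r) * (d ^ (2 * r) + d ^ (2 * (3 * r)))"
  have "A \<ge> 0" using \<open>C \<ge> 0\<close> by (simp add: A_def d_def)
  define D where "D = A * (d * (c1 + c2)) + 1"
  have "D > 0" using \<open>A \<ge> 0\<close> c1(1) c2(1) by (simp add: D_def d_def add_nonneg_pos)
  have main: "norm (szasz E N \<phi> x - P N x) \<le> D * real N powr (- real r) * (1 + coord_norm E x) powr (real r - K)"
    if x: "x \<in> orthant E" and N: "N \<ge> 1" for x N
  proof -
    from x obtain u where u: "x = (\<Sum>e\<in>E. u e *\<^sub>R e)" "\<forall>e\<in>E. 0 \<le> u e"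
      by (auto simp: orthant_def)
    have rep: "representation E x e = u e" if "e \<in> E" for e
      using representation_add_combination[OF E that, of 0 u] by (simp add: u(1) representation_zero)
    have x0: "representation E x e \<ge> 0" if "e \<in> E" for e
      using rep u(2) that by simp
    define X where "X = (\<Sum>e\<in>E. representation E x e)"
    have X0: "0 \<le> X" using x0 by (simp add: X_def sum_nonneg)
    have Xabs: "(\<Sum>e\<in>E. \<bar>representation E x e\<bar>) = X"
      unfolding X_def using x0 by (intro sum.cong) auto
    have leX: "representation E x e \<le> X" if "e \<in> E" for e
      unfolding X_def using that E(1) x0 by (intro member_le_sum) auto
    define k where "k \<gamma> = szasz_kernel E \<gamma> (real N *\<^sub>R x)" for \<gamma>
    define h where "h \<gamma> e = real (\<gamma> e) / real N - representation E x e" for \<gamma> :: "'a \<Rightarrow> nat" and e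
    have k0: "k \<gamma> \<ge> 0" for \<gamma>
      unfolding k_def using szasz_kernel_nonneg[OF E x0] by blast
    have point: "(\<Sum>e\<in>E. (real (\<gamma> e) / real N) *\<^sub>R e) = x + (\<Sum>e\<in>E. h \<gamma> e *\<^sub>R e)" for \<gamma>
      unfolding h_def scaleR_diff_left sum_subtractf
      using sum_representation_eq[OF E(2) _ E(1) order_refl, of x] E(3) by simp
    have mom: "((\<lambda>\<gamma>. k \<gamma> * h \<gamma> e ^ n) has_sum
        central_moment n (real N * representation E x e) / real N ^ n) (multi_indices E)" if "e \<in> E" for e n
      unfolding k_def h_def using has_sum_szasz_kernel_coordinate_moment[OF E x0 N that] .
    \<comment> \<open>The zeroth moment gives summability of the kernel; as the Schwartz function is
      bounded, the Szasz series then converges absolutely.\<close>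
    have "((\<lambda>\<gamma>. k \<gamma> * (\<Prod>e\<in>E. h \<gamma> e ^ 0)) has_sum J_poly E (\<lambda>_. 0) (real N *\<^sub>R x) / real N ^ mabs E (\<lambda>_. 0)) (multi_indices E)"
      unfolding k_def h_def using has_sum_szasz_kernel_moment[OF E x0 N] .
    then have "(\<lambda>\<gamma>. k \<gamma> * b) summable_on multi_indices E"
      by (auto dest: has_sum_imp_summable intro: summable_on_cmult_left)
    then have "(\<lambda>\<gamma>. norm (k \<gamma> *\<^sub>R \<phi> (x + (\<Sum>e\<in>E. h \<gamma> e *\<^sub>R e)))) summable_on multi_indices E"
      by (rule Infinite_Sum.abs_summable_on_comparison_test') (use k0 b in \<open>simp add: mult_left_mono\<close>)
    then have S1: "((\<lambda>\<gamma>. k \<gamma> *\<^sub>R \<phi> (x + (\<Sum>e\<in>E. h \<gamma> e *\<^sub>R e))) has_sum szasz E N \<phi> x) (multi_indices E)"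
      unfolding szasz_def point k_def by (rule has_sum_infsum[OF abs_summable_summable])
    have "((\<lambda>\<gamma>. \<Sum>\<mu>\<in>?M. (k \<gamma> * (\<Prod>e\<in>E. h \<gamma> e ^ \<mu> e)) *\<^sub>R ((1 / mfact E \<mu>) *\<^sub>R multi_deriv E \<mu> \<phi> x)) has_sum
        (\<Sum>\<mu>\<in>?M. (J_poly E \<mu> (real N *\<^sub>R x) / real N ^ mabs E \<mu>) *\<^sub>R ((1 / mfact E \<mu>) *\<^sub>R multi_deriv E \<mu> \<phi> x)))
        (multi_indices E)"
      unfolding k_def h_def
      by (intro has_sum_sum_finite has_sum_bounded_linear[OF bounded_linear_scaleR_left, unfolded o_def]
          has_sum_szasz_kernel_moment[OF E x0 N])
    then have S2: "((\<lambda>\<gamma>. k \<gamma> *\<^sub>R (\<Sum>\<mu>\<in>?M. ((\<Prod>e\<in>E. h \<gamma> e ^ \<mu> e) / mfact E \<mu>) *\<^sub>R multi_deriv E \<mu> \<phi> x)) has_sum P N x)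
        (multi_indices E)"
      by (simp add: P_def scaleR_sum_right mult.commute)
    have S3: "((\<lambda>\<gamma>. k \<gamma> *\<^sub>R (\<phi> (x + (\<Sum>e\<in>E. h \<gamma> e *\<^sub>R e)) -
        (\<Sum>\<mu>\<in>?M. ((\<Prod>e\<in>E. h \<gamma> e ^ \<mu> e) / mfact E \<mu>) *\<^sub>R multi_deriv E \<mu> \<phi> x)))
        has_sum (szasz E N \<phi> x - P N x)) (multi_indices E)"
      using has_sum_add[OF S1 has_sum_uminusI[OF S2]] by (simp add: scaleR_diff_right)
    \<comment> \<open>The majorant of the remainder up to a constant: orders 2r and 6r = 2r + 4r,
      the extreme powers in H^(2r) (1+H)^(4r).\<close>
    define Q where "Q \<gamma> = (\<Sum>e\<in>E. k \<gamma> * h \<gamma> e ^ (2 * r) + k \<gamma> * h \<gamma> e ^ (2 * (3 * r)))" for \<gamma>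
    define T where "T = (\<Sum>e\<in>E. central_moment (2 * r) (real N * representation E x e) / real N ^ (2 * r)
        + central_moment (2 * (3 * r)) (real N * representation E x e) / real N ^ (2 * (3 * r)))"
    have "(Q has_sum T) (multi_indices E)"
      unfolding Q_def[abs_def] T_def by (intro has_sum_sum_finite has_sum_add mom)
    then have S4: "((\<lambda>\<gamma>. A / (1 + X) ^ (4 * r) * Q \<gamma>) has_sum A / (1 + X) ^ (4 * r) * T) (multi_indices E)"
      by (rule has_sum_cmult_right)
    have rem: "norm (k \<gamma> *\<^sub>R (\<phi> (x + (\<Sum>e\<in>E. h \<gamma> e *\<^sub>R e)) -
        (\<Sum>\<mu>\<in>?M. ((\<Prod>e\<in>E. h \<gamma> e ^ \<mu> e) / mfact E \<mu>) *\<^sub>R multi_deriv E \<mu> \<phi> x)))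
        \<le> A / (1 + X) ^ (4 * r) * Q \<gamma>" for \<gamma>
    proof -
      define H where "H = (\<Sum>e\<in>E. \<bar>h \<gamma> e\<bar>)"
      have H0: "0 \<le> H" by (simp add: H_def sum_nonneg)
      define s1 where "s1 = (\<Sum>e\<in>E. h \<gamma> e ^ (2 * r))"
      define s2 where "s2 = (\<Sum>e\<in>E. h \<gamma> e ^ (2 * (3 * r)))"
      have s0: "0 \<le> s1" "0 \<le> s2" unfolding s1_def s2_def by (intro sum_nonneg; simp add: zero_le_even_power)+
      have d0: "0 \<le> d" by (simp add: d_def)
      have p1: "H ^ (2 * r) \<le> d ^ (2 * r) * s1"
        unfolding H_def d_def s1_def by (intro sum_abs_power_even_le E assms(4))
      have p2: "H ^ (2 * (3 * r)) \<le> d ^ (2 * (3 * r)) * s2"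
        unfolding H_def d_def s2_def using assms(4) by (intro sum_abs_power_even_le E) simp
      have "H ^ (2 * r) * (1 + H) ^ (4 * r) \<le> H ^ (2 * r) * (2 ^ (4 * r) * (1 + H ^ (4 * r)))"
        using H0 by (intro mult_left_mono one_plus_power_le) auto
      also have "\<dots> = 2 ^ (4 * r) * (H ^ (2 * r) + H ^ (2 * r + 4 * r))"
        unfolding power_add by algebra
      also have "2 * r + 4 * r = 2 * (3 * r)" by simp
      also have "2 ^ (4 * r) * (H ^ (2 * r) + H ^ (2 * (3 * r)))
          \<le> 2 ^ (4 * r) * (d ^ (2 * r) * s1 + d ^ (2 * (3 * r)) * s2)"
        using p1 p2 by (intro mult_left_mono add_mono) auto
      \<comment> \<open>Nonnegative cross terms are added so that the bound becomes a constant
        multiple of s1 + s2, hence of \<open>Q\<close>.\<close>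
      also have "\<dots> \<le> 2 ^ (4 * r) * ((d ^ (2 * r) + d ^ (2 * (3 * r))) * (s1 + s2))"
      proof (intro mult_left_mono)
        have "0 \<le> d ^ (2 * r) * s2" "0 \<le> d ^ (2 * (3 * r)) * s1"
          using s0 d0 by simp_all
        then show "d ^ (2 * r) * s1 + d ^ (2 * (3 * r)) * s2 \<le> (d ^ (2 * r) + d ^ (2 * (3 * r))) * (s1 + s2)"
          by (simp only: distrib_left distrib_right)
      qed simp
      finally have pH: "H ^ (2 * r) * (1 + H) ^ (4 * r) \<le> 2 ^ (4 * r) * ((d ^ (2 * r) + d ^ (2 * (3 * r))) * (s1 + s2))" .
      have Qs: "Q \<gamma> = k \<gamma> * (s1 + s2)"
        by (simp only: Q_def s1_def s2_def sum.distrib sum_distrib_left distrib_left)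
      have "norm (k \<gamma> *\<^sub>R (\<phi> (x + (\<Sum>e\<in>E. h \<gamma> e *\<^sub>R e)) -
          (\<Sum>\<mu>\<in>?M. ((\<Prod>e\<in>E. h \<gamma> e ^ \<mu> e) / mfact E \<mu>) *\<^sub>R multi_deriv E \<mu> \<phi> x)))
          \<le> k \<gamma> * (C * H ^ (2 * r) * (1 + H) ^ (4 * r) / (1 + X) ^ (4 * r))"
        unfolding norm_scaleR using C[of x "h \<gamma>"] k0[of \<gamma>]
        by (simp only: abs_of_nonneg H_def Xabs mult_left_mono)
      also have "\<dots> = k \<gamma> * C * (H ^ (2 * r) * (1 + H) ^ (4 * r)) / (1 + X) ^ (4 * r)"
        by (simp only: mult.assoc times_divide_eq_right)
      also have "\<dots> \<le> k \<gamma> * C * (2 ^ (4 * r) * ((d ^ (2 * r) + d ^ (2 * (3 * r))) * (s1 + s2))) / (1 + X) ^ (4 * r)"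
        using pH k0[of \<gamma>] \<open>C \<ge> 0\<close> X0 by (intro divide_right_mono mult_left_mono) auto
      also have "\<dots> = A / (1 + X) ^ (4 * r) * Q \<gamma>"
        by (simp only: A_def Qs times_divide_eq_left times_divide_eq_right mult_ac)
      finally show ?thesis .
    qed
    have N1: "real N \<ge> 1" using N by simp
    have "T \<le> (\<Sum>e\<in>E. c1 * (1 + X) ^ r / real N ^ r + c2 * (1 + X) ^ (3 * r) / real N ^ (3 * r))"
      unfolding T_def using c1(2)[OF N x0 leX] c2(2)[OF N x0 leX] by (intro sum_mono add_mono)
    \<comment> \<open>Both terms are coarsened to the worse powers, 3r for 1 + X and r for 1/N,
      using 1 + X >= 1 and N >= 1.\<close>
    also have "\<dots> \<le> (\<Sum>e\<in>E. c1 * (1 + X) ^ (3 * r) / real N ^ r + c2 * (1 + X) ^ (3 * r) / real N ^ r)"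
      using c1(1) c2(1) X0 N1
      by (intro sum_mono add_mono divide_right_mono divide_left_mono mult_left_mono power_increasing) auto
    also have "\<dots> = d * (c1 + c2) * ((1 + X) ^ (3 * r) / real N ^ r)"
      by (simp add: d_def add_divide_distrib algebra_simps)
    finally have T: "T \<le> d * (c1 + c2) * ((1 + X) ^ (3 * r) / real N ^ r)" .
    have ratio: "(1 + X) ^ (3 * r) / (1 + X) ^ (4 * r) = 1 / (1 + X) ^ r"
    proof -
      have "(1 + X) ^ (4 * r) = (1 + X) ^ (3 * r) * (1 + X) ^ r"
        by (simp flip: power_add)
      then show ?thesis using X0 by simp
    qed
    \<comment> \<open>The Euclidean norm is at most the coordinate sum \<open>X\<close>, and -r <= r
      - K compares the exponents on a base at least 1.\<close>
    have decay: "1 / (1 + X) ^ r \<le> (1 + coord_norm E x) powr (real r - K)"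
    proof -
      have cn: "coord_norm E x \<ge> 0" "coord_norm E x \<le> X"
        unfolding coord_norm_def X_def using x0 by (simp_all add: L2_set_nonneg L2_set_le_sum)
      then have "1 / (1 + X) ^ r \<le> 1 / (1 + coord_norm E x) ^ r"
        by (intro divide_left_mono power_mono mult_pos_pos zero_less_power) auto
      also have "\<dots> = (1 + coord_norm E x) powr (- real r)"
        using cn by (simp add: powr_minus_divide powr_realpow)
      also have "\<dots> \<le> (1 + coord_norm E x) powr (real r - K)"
        using cn assms(7) by (intro powr_mono) auto
      finally show ?thesis .
    qed
    have Npow: "1 / real N ^ r = real N powr (- real r)"
      using N by (simp add: powr_minus_divide powr_realpow)
    have "norm (szasz E N \<phi> x - P N x) \<le> A / (1 + X) ^ (4 * r) * T"
      by (rule norm_infsum_le[OF S3 S4 rem])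
    also have "\<dots> \<le> A / (1 + X) ^ (4 * r) * (d * (c1 + c2) * ((1 + X) ^ (3 * r) / real N ^ r))"
      using T \<open>A \<ge> 0\<close> X0 by (intro mult_left_mono) auto
    also have "\<dots> = (D - 1) * (1 / real N ^ r) * ((1 + X) ^ (3 * r) / (1 + X) ^ (4 * r))"
      by (simp add: D_def mult_ac)
    also have "\<dots> = (D - 1) * real N powr (- real r) * (1 / (1 + X) ^ r)"
      by (simp only: ratio Npow)
    also have "\<dots> \<le> D * real N powr (- real r) * (1 + coord_norm E x) powr (real r - K)"
      using decay \<open>D > 0\<close> X0 by (intro mult_mono) auto
    finally show ?thesis .
  qed
  have "mabs E \<mu> \<le> 2 * r - 1 \<longleftrightarrow> mabs E \<mu> < 2 * r" for \<mu>
    using assms(4) by linarith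
  then show ?thesis
    using \<open>D > 0\<close> main poly_degree_le_J_poly[OF E(1)]
    by (auto simp: P_def intro!: exI[of _ D] exI[of _ "\<lambda>N x. szasz E N \<phi> x - P N x"])
qed

end
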